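(* Let $m\ge k\ge 3$ be integers. A $(3,k,m)$ Latin trade exists in each of the following cases: (1) $k=4$, except for $m=6$ and $m=7$, for which no $(3,4,m)$ Latin trade exists, and except possibly for $m=11$; (2) $k=5$, except possibly for $m=6$; (3) $6\le k\le 13$; (4) $k=15$; (5) $k\ge 4$ and $m\ge k^2$; (6) $k\ge 4$ and $m$ is a multiple of $5$, except possibly for $m=30$; (7) $k\ge 4$ and $m$ is a multiple of $7$, except possibly for $m=42$ and for $(k,m)=(4,7)$. ("Except possibly" means that nothing is asserted for the indicated values by that item.)
   Context: A partial Latin square is a square array, some of whose cells are filled with symbols from a finite set and the others empty, such that each symbol occurs at most once in each row and at most once in each column. For a positive integer $\mu$, a $\mu$-way Latin trade is a tuple $(T_1,\dots,T_\mu)$ of partial Latin squares with exactly the same set of filled cells such that: every filled cell $(i,j)$ contains pairwise different entries in $T_1,\dots,T_\mu$; for each row $i$, the set of symbols in row $i$ is the same in all of $T_1,\dots,T_\mu$; and for each column $j$, the set of symbols in column $j$ is the same in all of $T_1,\dots,T_\mu$. For $\mu\le k\le m$, a $(\mu,k,m)$ Latin trade (also called a $\mu$-way $k$-homogeneous Latin trade) is a $\mu$-way Latin trade $(T_1,\dots,T_\mu)$ consisting of $m\times m$ arrays on a set of $m$ symbols such that in each $T_r$ every row has exactly $k$ filled cells, every column has exactly $k$ filled cells, and every symbol appears exactly $k$ times. *)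

theory Defs
  imports Main
begin

text \<open>An $n \times n$ array with possibly empty cells is a function
  \<open>L :: nat \<Rightarrow> nat \<Rightarrow> 'a option\<close>, where \<open>L i j = None\<close> means that the cell \<open>(i, j)\<close> is empty.
  Only the cells with \<open>i < n\<close> and \<open>j < n\<close> belong to the array; values outside that range are
  never inspected.\<close>

type_synonym 'a array = "nat \<Rightarrow> nat \<Rightarrow> 'a option"

definition filled :: "nat \<Rightarrow> 'a array \<Rightarrow> (nat \<times> nat) set" where
  "filled n L = {(i, j). i < n \<and> j < n \<and> L i j \<noteq> None}"

definition row_symbols :: "nat \<Rightarrow> 'a array \<Rightarrow> nat \<Rightarrow> 'a set" where
  "row_symbols n L i = {x. \<exists>j<n. L i j = Some x}"

definition col_symbols :: "nat \<Rightarrow> 'a array \<Rightarrow> nat \<Rightarrow> 'a set" where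
  "col_symbols n L j = {x. \<exists>i<n. L i j = Some x}"

definition partial_latin_square :: "nat \<Rightarrow> 'a set \<Rightarrow> 'a array \<Rightarrow> bool" where
  "partial_latin_square n S L \<longleftrightarrow>
     finite S \<and>
     (\<forall>i<n. \<forall>j<n. \<forall>x. L i j = Some x \<longrightarrow> x \<in> S) \<and>
     (\<forall>x\<in>S. \<forall>i<n. card {j. j < n \<and> L i j = Some x} \<le> 1) \<and>
     (\<forall>x\<in>S. \<forall>j<n. card {i. i < n \<and> L i j = Some x} \<le> 1)"

definition latin_trade :: "nat \<Rightarrow> nat \<Rightarrow> 'a set \<Rightarrow> 'a array list \<Rightarrow> bool" where
  "latin_trade \<mu> n S Ts \<longleftrightarrow>
     1 \<le> \<mu> \<and> length Ts = \<mu> \<and>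
     (\<forall>L\<in>set Ts. partial_latin_square n S L) \<and>
     (\<forall>L\<in>set Ts. \<forall>L'\<in>set Ts. filled n L = filled n L') \<and>
     (\<forall>L\<in>set Ts. \<forall>(i, j)\<in>filled n L. distinct (map (\<lambda>L'. L' i j) Ts)) \<and>
     (\<forall>L\<in>set Ts. \<forall>L'\<in>set Ts. \<forall>i<n. row_symbols n L i = row_symbols n L' i) \<and>
     (\<forall>L\<in>set Ts. \<forall>L'\<in>set Ts. \<forall>j<n. col_symbols n L j = col_symbols n L' j)"

definition homogeneous_latin_trade ::
    "nat \<Rightarrow> nat \<Rightarrow> nat \<Rightarrow> 'a set \<Rightarrow> 'a array list \<Rightarrow> bool" where
  "homogeneous_latin_trade \<mu> k m S Ts \<longleftrightarrow>
     \<mu> \<le> k \<and> k \<le> m \<and> card S = m \<and> latin_trade \<mu> m S Ts \<and>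
     (\<forall>L\<in>set Ts.
        (\<forall>i<m. card {j. j < m \<and> L i j \<noteq> None} = k) \<and>
        (\<forall>j<m. card {i. i < m \<and> L i j \<noteq> None} = k) \<and>
        (\<forall>x\<in>S. card {(i, j). i < m \<and> j < m \<and> L i j = Some x} = k))"

text \<open>Relabelling symbols preserves trades, so taking them from the infinite type \<^typ>\<open>nat\<close>
  loses no generality.\<close>

definition latin_trade_exists :: "nat \<Rightarrow> nat \<Rightarrow> nat \<Rightarrow> bool" where
  "latin_trade_exists \<mu> k m \<longleftrightarrow>
     (\<exists>(S :: nat set) Ts. homogeneous_latin_trade \<mu> k m S Ts)"

end

theory Submission
  imports Defs
begin

text \<open>A trade is treated as a system of triples (row, column, symbol), one for each of its \<open>\<mu>\<close>
  arrays. Apart from the disjointness of the \<open>\<mu>\<close> systems, the defining conditions become one condition,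
  \<open>face\<close>, imposed on the three cyclic rotations of the triples, so that a construction can be
  verified for a single face.

  \<^bold>\<open>Fixed degree.\<close> Three partial bijections \<open>c \<mapsto> a\<close> of residues modulo \<open>m\<close> that have a common
  domain, a common image and a common set of differences \<open>a - c\<close>, and that never agree, form the
  row 0 of a trade; translating that row by all residues along the diagonal gives the other rows
  (\<open>has_trade_develop\<close>). If the same holds for integers and the domain, the image and the
  difference set have spread at most \<open>w\<close>, then the row works modulo every \<open>m \<ge> w\<close>, so one explicit
  integer row of spread \<open>k\<close> or \<open>k + 1\<close> settles a degree \<open>k\<close> for all orders (up to the case
  \<open>m = k\<close>, a family of cyclic Latin squares). Such rows are given for \<open>k = 7, \<dots>, 13\<close> and \<open>15\<close>,
  and nearly so for \<open>k = 6\<close>; degrees 4 and 5 follow from a few small orders by direct sums.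

  \<^bold>\<open>Large order.\<close> Integer rows can be placed side by side, far enough apart for their domains,
  images and differences to stay disjoint. The rows of size \<open>6, \<dots>, 11\<close> thereby produce a
  trade for every \<open>k \<ge> 6\<close> and every \<open>m \<ge> 4 * k\<close> (\<open>has_trade_large\<close>), hence for \<open>m \<ge> k\<^sup>2\<close>.

  \<^bold>\<open>Multiples of 5 and 7.\<close> From two orthogonal Latin squares of order \<open>l\<close> one blows up the cells of
  the first into trades of order \<open>n\<close>; if the degree of the trade placed in a cell depends only on
  the entry \<open>t\<close> of the second square, the result has order \<open>l * n\<close> and degree \<open>\<Sum>t<l. d t\<close>
  (\<open>has_trade_blowup\<close>). Only \<open>l\<close> odd and \<open>l = 4\<close> are used: if \<open>m = 5 * x\<close>, peeling
  factors 4 off \<open>x\<close> ends with \<open>x\<close> odd, or twice an odd number, which is handled by blowing up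
  trades of order 5 or 10, and likewise for 7.

  \<^bold>\<open>Nonexistence.\<close> In a \<open>(3, 4, m)\<close> trade each symbol of a row is missing from only one filled cell
  of that row. For the complements of the symbol sets of rows and columns, which have \<open>m - 4\<close>
  elements, this says that they nearly coincide at filled cells, and that the excess at different
  filled cells of a row is disjoint (\<open>concentrated\<close>). Since the complements have size
  2 or 3 when \<open>m\<close> is 6 or 7, counting incidences leaves nearly no freedom, and
  following a disjoint pair from a row to a column and back produces a contradiction
  (\<open>no_dual_concentrated_families\<close>).\<close>

section \<open>Trades as systems of triples\<close>

text \<open>Read with rows, columns and symbols as the three coordinates, \<open>face\<close> says that a cell holds at
  most one symbol, that the filled cells agree in all arrays, and that a row has \<open>k\<close> filled cells.
  After a rotation of the coordinates it says that a symbol occurs at most once in a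
  column, that the columns have the same symbol sets, and so on.\<close>

definition face :: "nat \<Rightarrow> nat \<Rightarrow> 'a set \<Rightarrow> (nat \<Rightarrow> 'a \<Rightarrow> 'b \<Rightarrow> 'c \<Rightarrow> bool) \<Rightarrow> bool" where
  "face \<mu> k X T \<longleftrightarrow>
     (\<forall>i<\<mu>. \<forall>x y z z'. T i x y z \<longrightarrow> T i x y z' \<longrightarrow> z = z') \<and>
     (\<forall>i<\<mu>. \<forall>j<\<mu>. \<forall>x y z. T i x y z \<longrightarrow> (\<exists>z'. T j x y z')) \<and>
     (\<forall>i<\<mu>. \<forall>x\<in>X. card {(y, z). T i x y z} = k)"

definition trade ::
    "nat \<Rightarrow> nat \<Rightarrow> 'r set \<Rightarrow> 'c set \<Rightarrow> 's set \<Rightarrow> (nat \<Rightarrow> 'r \<Rightarrow> 'c \<Rightarrow> 's \<Rightarrow> bool) \<Rightarrow> bool" where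
  "trade \<mu> k R C S T \<longleftrightarrow>
     finite R \<and> finite C \<and> finite S \<and>
     (\<forall>i<\<mu>. \<forall>r c s. T i r c s \<longrightarrow> r \<in> R \<and> c \<in> C \<and> s \<in> S) \<and>
     (\<forall>i<\<mu>. \<forall>j<\<mu>. \<forall>r c s. T i r c s \<longrightarrow> T j r c s \<longrightarrow> i = j) \<and>
     face \<mu> k R T \<and> face \<mu> k C (\<lambda>i c s r. T i r c s) \<and> face \<mu> k S (\<lambda>i s r c. T i r c s)"

lemma face_unique: "face \<mu> k X T \<Longrightarrow> i < \<mu> \<Longrightarrow> T i x y z \<Longrightarrow> T i x y z' \<Longrightarrow> z = z'"
  unfolding face_def by blast

lemma face_exchange: "face \<mu> k X T \<Longrightarrow> i < \<mu> \<Longrightarrow> j < \<mu> \<Longrightarrow> T i x y z \<Longrightarrow> \<exists>z'. T j x y z'"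
  unfolding face_def by blast

lemma face_degree: "face \<mu> k X T \<Longrightarrow> i < \<mu> \<Longrightarrow> x \<in> X \<Longrightarrow> card {(y, z). T i x y z} = k"
  unfolding face_def by blast

lemma face_card_second:
  assumes "face \<mu> k X T" "i < \<mu>" "x \<in> X"
  shows "card {y. \<exists>z. T i x y z} = k"
proof -
  have "{y. \<exists>z. T i x y z} = fst ` {(y, z). T i x y z}" by force
  moreover have "inj_on fst {(y, z). T i x y z}"
    using face_unique[OF assms(1,2)] by (auto simp: inj_on_def)
  ultimately show ?thesis using face_degree[OF assms] by (simp add: card_image)
qed

lemma face_card_third:
  assumes "face \<mu> k X T" "i < \<mu>" "x \<in> X"
    and uniq: "\<And>y y' z. T i x y z \<Longrightarrow> T i x y' z \<Longrightarrow> y = y'"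
  shows "card {z. \<exists>y. T i x y z} = k"
proof -
  have "{z. \<exists>y. T i x y z} = snd ` {(y, z). T i x y z}" by force
  moreover have "inj_on snd {(y, z). T i x y z}"
    using uniq by (auto simp: inj_on_def)
  ultimately show ?thesis using face_degree[OF assms(1-3)] by (simp add: card_image)
qed

lemma face_relabel:
  assumes F: "face \<mu> k X T"
    and supp: "\<And>i x y z. i < \<mu> \<Longrightarrow> T i x y z \<Longrightarrow> x \<in> X \<and> y \<in> Y \<and> z \<in> Z"
    and f: "bij_betw f X' X" and g: "bij_betw g Y' Y" and h: "bij_betw h Z' Z"
  shows "face \<mu> k X' (\<lambda>i x y z. x \<in> X' \<and> y \<in> Y' \<and> z \<in> Z' \<and> T i (f x) (g y) (h z))"
  unfolding face_def
proof (intro conjI allI impI ballI)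
  fix i x y z z' assume "i < \<mu>"
    and "x \<in> X' \<and> y \<in> Y' \<and> z \<in> Z' \<and> T i (f x) (g y) (h z)"
    and "x \<in> X' \<and> y \<in> Y' \<and> z' \<in> Z' \<and> T i (f x) (g y) (h z')"
  then show "z = z'" using face_unique[OF F] h by (metis bij_betw_def inj_onD)
next
  fix i j x y z assume "i < \<mu>" "j < \<mu>"
    and a: "x \<in> X' \<and> y \<in> Y' \<and> z \<in> Z' \<and> T i (f x) (g y) (h z)"
  then obtain w where w: "T j (f x) (g y) w" using face_exchange[OF F] by blast
  then have "w \<in> h ` Z'" using supp[OF \<open>j < \<mu>\<close> w] h by (simp add: bij_betw_def)
  then obtain z' where "z' \<in> Z'" "w = h z'" by blast
  then show "\<exists>z'. x \<in> X' \<and> y \<in> Y' \<and> z' \<in> Z' \<and> T j (f x) (g y) (h z')"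
    using w a by auto
next
  fix i x assume i: "i < \<mu>" and x: "x \<in> X'"
  have "bij_betw (map_prod g h) {(y, z). x \<in> X' \<and> y \<in> Y' \<and> z \<in> Z' \<and> T i (f x) (g y) (h z)}
      {(y, z). T i (f x) y z}"
    unfolding bij_betw_def
  proof
    show "inj_on (map_prod g h) {(y, z). x \<in> X' \<and> y \<in> Y' \<and> z \<in> Z' \<and> T i (f x) (g y) (h z)}"
      using g h by (auto simp: inj_on_def bij_betw_def)
    show "map_prod g h ` {(y, z). x \<in> X' \<and> y \<in> Y' \<and> z \<in> Z' \<and> T i (f x) (g y) (h z)} =
        {(y, z). T i (f x) y z}"
    proof (intro equalityI subsetI)
      fix p assume "p \<in> {(y, z). T i (f x) y z}"
      then obtain y z where p: "p = (y, z)" and T: "T i (f x) y z" by blast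
      then obtain y' z' where "y' \<in> Y'" "z' \<in> Z'" "y = g y'" "z = h z'"
        using supp[OF i T] g h by (auto simp: bij_betw_def)
      then show "p \<in> map_prod g h `
          {(y, z). x \<in> X' \<and> y \<in> Y' \<and> z \<in> Z' \<and> T i (f x) (g y) (h z)}"
        using p T x by force
    qed auto
  qed
  then show "card {(y, z). x \<in> X' \<and> y \<in> Y' \<and> z \<in> Z' \<and> T i (f x) (g y) (h z)} = k"
    using face_degree[OF F i] f x by (metis (lifting) bij_betwE bij_betw_same_card)
qed

lemma trade_relabel:
  assumes T: "trade \<mu> k R C S T"
    and f: "bij_betw f R' R" and g: "bij_betw g C' C" and h: "bij_betw h S' S"
  shows "trade \<mu> k R' C' S' (\<lambda>i r c s. r \<in> R' \<and> c \<in> C' \<and> s \<in> S' \<and> T i (f r) (g c) (h s))"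
proof -
  have supp: "\<And>i r c s. i < \<mu> \<Longrightarrow> T i r c s \<Longrightarrow> r \<in> R \<and> c \<in> C \<and> s \<in> S"
    using T unfolding trade_def by blast
  have F: "face \<mu> k R T" "face \<mu> k C (\<lambda>i c s r. T i r c s)" "face \<mu> k S (\<lambda>i s r c. T i r c s)"
    using T unfolding trade_def by blast+
  have fin: "finite R'" "finite C'" "finite S'"
    using T bij_betw_finite[OF f] bij_betw_finite[OF g] bij_betw_finite[OF h]
    unfolding trade_def by blast+
  note 1 = face_relabel[OF F(1) supp f g h]
  have 2: "face \<mu> k C' (\<lambda>i c s r. c \<in> C' \<and> s \<in> S' \<and> r \<in> R' \<and> T i (f r) (g c) (h s))"
    by (rule face_relabel[OF F(2) _ g h f]) (use supp in blast)
  have 3: "face \<mu> k S' (\<lambda>i s r c. s \<in> S' \<and> r \<in> R' \<and> c \<in> C' \<and> T i (f r) (g c) (h s))"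
    by (rule face_relabel[OF F(3) _ h f g]) (use supp in blast)
  have comm: "c \<in> C' \<and> s \<in> S' \<and> r \<in> R' \<and> P \<longleftrightarrow> r \<in> R' \<and> c \<in> C' \<and> s \<in> S' \<and> P"
    "s \<in> S' \<and> r \<in> R' \<and> c \<in> C' \<and> P \<longleftrightarrow> r \<in> R' \<and> c \<in> C' \<and> s \<in> S' \<and> P" for r c s P
    by blast+
  show ?thesis
    unfolding trade_def
  proof (intro conjI)
    show "face \<mu> k C' (\<lambda>i c s r. r \<in> R' \<and> c \<in> C' \<and> s \<in> S' \<and> T i (f r) (g c) (h s))"
      using 2 unfolding comm(1) .
    show "face \<mu> k S' (\<lambda>i s r c. r \<in> R' \<and> c \<in> C' \<and> s \<in> S' \<and> T i (f r) (g c) (h s))"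
      using 3 unfolding comm(2) .
    show "\<forall>i<\<mu>. \<forall>j<\<mu>. \<forall>r c s. r \<in> R' \<and> c \<in> C' \<and> s \<in> S' \<and> T i (f r) (g c) (h s) \<longrightarrow>
        r \<in> R' \<and> c \<in> C' \<and> s \<in> S' \<and> T j (f r) (g c) (h s) \<longrightarrow> i = j"
      using T unfolding trade_def by blast
  qed (use 1 fin in auto)
qed

lemma face_swap:
  assumes F: "face \<mu> k X T"
    and G: "\<And>i x y y' z. i < \<mu> \<Longrightarrow> T i x y z \<Longrightarrow> T i x y' z \<Longrightarrow> y = y'"
    and H: "\<And>i j x y z. i < \<mu> \<Longrightarrow> j < \<mu> \<Longrightarrow> T i x y z \<Longrightarrow> \<exists>y'. T j x y' z"
  shows "face \<mu> k X (\<lambda>i x z y. T i x y z)"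
  unfolding face_def
proof (intro conjI allI impI ballI)
  fix i x assume i: "i < \<mu>" and x: "x \<in> X"
  have "{(z, y). T i x y z} = prod.swap ` {(y, z). T i x y z}" by force
  then show "card {(z, y). T i x y z} = k"
    using face_degree[OF F i x] by (simp add: card_image)
qed (use G H in blast)+

text \<open>Faces are oriented cyclically, so exchanging rows and columns is not among their rotations; each
  face of the transpose combines the count of one face with the uniqueness of another.\<close>

lemma trade_transpose:
  assumes "trade \<mu> k R C S T"
  shows "trade \<mu> k C R S (\<lambda>i c r s. T i r c s)"
proof -
  have F: "face \<mu> k R T" "face \<mu> k C (\<lambda>i c s r. T i r c s)" "face \<mu> k S (\<lambda>i s r c. T i r c s)"
    using assms unfolding trade_def by blast+
  have "face \<mu> k C (\<lambda>i c r s. T i r c s)"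
    by (rule face_swap[OF F(2)]) (use face_unique[OF F(1)] face_exchange[OF F(1)] in blast)+
  moreover have "face \<mu> k R (\<lambda>i r s c. T i r c s)"
    by (rule face_swap[OF F(1)]) (use face_unique[OF F(3)] face_exchange[OF F(3)] in blast)+
  moreover have "face \<mu> k S (\<lambda>i s c r. T i r c s)"
    by (rule face_swap[OF F(3)]) (use face_unique[OF F(2)] face_exchange[OF F(2)] in blast)+
  ultimately show ?thesis using assms unfolding trade_def by blast
qed

definition has_trade :: "nat \<Rightarrow> nat \<Rightarrow> nat \<Rightarrow> bool" where
  "has_trade \<mu> k m \<longleftrightarrow>
     (\<exists>T :: nat \<Rightarrow> nat \<Rightarrow> nat \<Rightarrow> nat \<Rightarrow> bool. trade \<mu> k {..<m} {..<m} {..<m} T)"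

text \<open>Only the number of rows, columns and symbols matters, which allows the constructions to use
  residues or pairs as labels.\<close>

lemma has_tradeI:
  assumes "trade \<mu> k R C S T" "card R = m" "card C = m" "card S = m"
  shows "has_trade \<mu> k m"
proof -
  have fin: "finite R" "finite C" "finite S" using assms(1) unfolding trade_def by blast+
  obtain f g h where "bij_betw f {..<m} R" "bij_betw g {..<m} C" "bij_betw h {..<m} S"
    using fin assms(2-4) ex_bij_betw_nat_finite by (metis atLeast0LessThan)
  from trade_relabel[OF assms(1) this] show ?thesis unfolding has_trade_def by blast
qed

lemma latin_trade_existsI:
  assumes "has_trade \<mu> k m" and "1 \<le> \<mu>" "\<mu> \<le> k" "k \<le> m"
  shows "latin_trade_exists \<mu> k m"
proof -
  obtain T :: "nat \<Rightarrow> nat \<Rightarrow> nat \<Rightarrow> nat \<Rightarrow> bool" where T: "trade \<mu> k {..<m} {..<m} {..<m} T"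
    using assms(1) unfolding has_trade_def by blast
  define L where "L i r c = (if \<exists>s. T i r c s then Some (THE s. T i r c s) else None)" for i r c
  have F: "face \<mu> k {..<m} T" "face \<mu> k {..<m} (\<lambda>i c s r. T i r c s)"
      "face \<mu> k {..<m} (\<lambda>i s r c. T i r c s)"
    using T unfolding trade_def by blast+
  have supp: "\<And>i r c s. i < \<mu> \<Longrightarrow> T i r c s \<Longrightarrow> r < m \<and> c < m \<and> s < m"
    using T unfolding trade_def by blast
  have disj: "\<And>i j r c s. i < \<mu> \<Longrightarrow> j < \<mu> \<Longrightarrow> T i r c s \<Longrightarrow> T j r c s \<Longrightarrow> i = j"
    using T unfolding trade_def by blast
  have LS: "L i r c = Some s \<longleftrightarrow> T i r c s" if "i < \<mu>" for i r c s
  proof -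
    have "(THE s. T i r c s) = s'" if "T i r c s'" for s'
      using that face_unique[OF F(1) \<open>i < \<mu>\<close>] by blast
    then show ?thesis unfolding L_def by auto
  qed
  have LN: "L i r c \<noteq> None \<longleftrightarrow> (\<exists>s. T i r c s)" for i r c unfolding L_def by auto
  let ?Ts = "map L [0..<\<mu>]"
  have Ts: "(\<forall>M\<in>set ?Ts. \<forall>M'\<in>set ?Ts. Q M M') \<longleftrightarrow> (\<forall>i<\<mu>. \<forall>j<\<mu>. Q (L i) (L j))" for Q
    by auto
  have pls: "partial_latin_square m {..<m} (L i)" if i: "i < \<mu>" for i
    unfolding partial_latin_square_def
  proof (intro conjI ballI allI impI)
    fix s r assume "r < m"
    have "c = c'" if "T i r c s" "T i r c' s" for c c' using face_unique[OF F(3) i] that by blast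
    then show "card {c. c < m \<and> L i r c = Some s} \<le> 1"
      unfolding LS[OF i] by (simp add: card_le_Suc0_iff_eq)
  next
    fix s c assume "c < m"
    have "r = r'" if "T i r c s" "T i r' c s" for r r' using face_unique[OF F(2) i] that by blast
    then show "card {r. r < m \<and> L i r c = Some s} \<le> 1"
      unfolding LS[OF i] by (simp add: card_le_Suc0_iff_eq)
  qed (use supp[OF i] LS[OF i] in auto)
  have trade: "latin_trade \<mu> m {..<m} ?Ts"
    unfolding latin_trade_def
  proof (intro conjI)
    have "filled m (L i) \<subseteq> filled m (L j)" if "i < \<mu>" "j < \<mu>" for i j
      unfolding filled_def LN using face_exchange[OF F(1) that] by blast
    then show "\<forall>L\<in>set ?Ts. \<forall>L'\<in>set ?Ts. filled m L = filled m L'"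
      unfolding Ts by (meson subset_antisym)
    show "\<forall>L\<in>set ?Ts. \<forall>(i, j)\<in>filled m L. distinct (map (\<lambda>L'. L' i j) ?Ts)"
    proof clarsimp
      fix i r c assume i: "i < \<mu>" and "(r, c) \<in> filled m (L i)"
      then obtain s where s: "T i r c s" unfolding filled_def LN by blast
      show "distinct (map ((\<lambda>L'. L' r c) \<circ> L) [0..<\<mu>])"
        unfolding distinct_map
      proof (intro conjI inj_onI)
        fix j j' assume j: "j \<in> set [0..<\<mu>]" "j' \<in> set [0..<\<mu>]"
          and eq: "((\<lambda>L'. L' r c) \<circ> L) j = ((\<lambda>L'. L' r c) \<circ> L) j'"
        then have jj: "j < \<mu>" "j' < \<mu>" and "L j r c = L j' r c" by auto
        obtain s' where s': "T j r c s'" using face_exchange[OF F(1) i jj(1) s] by blast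
        then have "T j' r c s'"
          using LS[OF jj(1)] LS[OF jj(2)] \<open>L j r c = L j' r c\<close> by metis
        then show "j = j'" using disj jj s' by blast
      qed simp
    qed
    have "row_symbols m (L i) r \<subseteq> row_symbols m (L j) r" if "i < \<mu>" "j < \<mu>" for i j r
      unfolding row_symbols_def LS[OF that(1)] LS[OF that(2)]
      using face_exchange[OF F(3) that] supp[OF that(2)] by blast
    then show "\<forall>L\<in>set ?Ts. \<forall>L'\<in>set ?Ts. \<forall>i<m. row_symbols m L i = row_symbols m L' i"
      unfolding Ts by (meson subset_antisym)
    have "col_symbols m (L i) c \<subseteq> col_symbols m (L j) c" if "i < \<mu>" "j < \<mu>" for i j c
      unfolding col_symbols_def LS[OF that(1)] LS[OF that(2)]
      using face_exchange[OF F(2) that] supp[OF that(2)] by blast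
    then show "\<forall>L\<in>set ?Ts. \<forall>L'\<in>set ?Ts. \<forall>j<m. col_symbols m L j = col_symbols m L' j"
      unfolding Ts by (meson subset_antisym)
  qed (use assms(2) pls in auto)
  have "homogeneous_latin_trade \<mu> k m {..<m} ?Ts"
    unfolding homogeneous_latin_trade_def
  proof (intro conjI ballI allI impI)
    fix M r assume "M \<in> set ?Ts" and r: "r < m"
    then obtain i where i: "i < \<mu>" and M: "M = L i" by auto
    have "{c. c < m \<and> M r c \<noteq> None} = {c. \<exists>s. T i r c s}" unfolding M LN using supp[OF i] by blast
    then show "card {c. c < m \<and> M r c \<noteq> None} = k" using face_card_second[OF F(1) i] r by simp
  next
    fix M c assume "M \<in> set ?Ts" and c: "c < m"
    then obtain i where i: "i < \<mu>" and M: "M = L i" by auto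
    have "{r. r < m \<and> M r c \<noteq> None} = {r. \<exists>s. T i r c s}" unfolding M LN using supp[OF i] by blast
    then show "card {r. r < m \<and> M r c \<noteq> None} = k"
      using face_card_third[OF F(2) i] face_unique[OF F(1) i] c by simp
  next
    fix M s assume "M \<in> set ?Ts" and s: "s \<in> {..<m}"
    then obtain i where i: "i < \<mu>" and M: "M = L i" by auto
    have "{(r, c). r < m \<and> c < m \<and> M r c = Some s} = {(r, c). T i r c s}"
      unfolding M LS[OF i] using supp[OF i] by blast
    then show "card {(r, c). r < m \<and> c < m \<and> M r c = Some s} = k"
      using face_degree[OF F(3) i s] by simp
  qed (use assms trade in auto)
  then show ?thesis unfolding latin_trade_exists_def by blast
qed

lemma trade_if_homogeneous_latin_trade:
  assumes "homogeneous_latin_trade \<mu> k m S Ts"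
  shows "trade \<mu> k {..<m} {..<m} S (\<lambda>i r c s. r < m \<and> c < m \<and> (Ts ! i) r c = Some s)"
proof -
  have LT: "latin_trade \<mu> m S Ts" and len: "length Ts = \<mu>" and "1 \<le> \<mu>"
    using assms unfolding homogeneous_latin_trade_def latin_trade_def by blast+
  have mem: "Ts ! i \<in> set Ts" if "i < \<mu>" for i using that len by simp
  have pls: "partial_latin_square m S (Ts ! i)" if "i < \<mu>" for i
    using LT mem[OF that] unfolding latin_trade_def by blast
  have fin: "finite S" using pls \<open>1 \<le> \<mu>\<close> unfolding partial_latin_square_def by force
  have inS: "s \<in> S" if "i < \<mu>" "r < m" "c < m" "(Ts ! i) r c = Some s" for i r c s
    using pls[OF that(1)] that unfolding partial_latin_square_def by blast
  have one: "a = b" if "card {j. j < m \<and> Q j} \<le> 1" "a < m" "b < m" "Q a" "Q b" for Q and a b :: nat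
    using that by (auto simp: card_le_Suc0_iff_eq)
  have col_uniq: "r = r'" if "i < \<mu>" "r < m" "r' < m" "c < m" "(Ts ! i) r c = Some s" "(Ts ! i) r' c = Some s"
    for i r r' c s
    using one[of "\<lambda>r. (Ts ! i) r c = Some s" r r'] pls[OF that(1)] inS[OF that(1,2,4,5)] that
    unfolding partial_latin_square_def by blast
  have row_uniq: "c = c'" if "i < \<mu>" "r < m" "c < m" "c' < m" "(Ts ! i) r c = Some s" "(Ts ! i) r c' = Some s"
    for i r c c' s
    using one[of "\<lambda>c. (Ts ! i) r c = Some s" c c'] pls[OF that(1)] inS[OF that(1,2,3,5)] that
    unfolding partial_latin_square_def by blast
  have filled: "\<exists>s'. (Ts ! j) r c = Some s'"
    if "i < \<mu>" "j < \<mu>" "r < m" "c < m" "(Ts ! i) r c = Some s" for i j r c s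
  proof -
    have "filled m (Ts ! i) = filled m (Ts ! j)"
      using LT mem that unfolding latin_trade_def by blast
    moreover have "(r, c) \<in> filled m (Ts ! i)" using that unfolding filled_def by simp
    ultimately show ?thesis unfolding filled_def by blast
  qed
  have rows: "\<exists>c'<m. (Ts ! j) r c' = Some s"
    if "i < \<mu>" "j < \<mu>" "r < m" "c < m" "(Ts ! i) r c = Some s" for i j r c s
  proof -
    have "row_symbols m (Ts ! i) r = row_symbols m (Ts ! j) r"
      using LT mem that unfolding latin_trade_def by blast
    then show ?thesis using that unfolding row_symbols_def by blast
  qed
  have cols: "\<exists>r'<m. (Ts ! j) r' c = Some s"
    if "i < \<mu>" "j < \<mu>" "r < m" "c < m" "(Ts ! i) r c = Some s" for i j r c s
  proof -
    have "col_symbols m (Ts ! i) c = col_symbols m (Ts ! j) c"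
      using LT mem that unfolding latin_trade_def by blast
    then show ?thesis using that unfolding col_symbols_def by blast
  qed
  have disj: "i = j"
    if "i < \<mu>" "j < \<mu>" "r < m" "c < m" "(Ts ! i) r c = Some s" "(Ts ! j) r c = Some s" for i j r c s
  proof -
    have "(r, c) \<in> filled m (Ts ! i)" using that unfolding filled_def by simp
    then have "distinct (map (\<lambda>L. L r c) Ts)"
      using LT mem[OF that(1)] unfolding latin_trade_def by blast
    then show ?thesis using that len by (force simp: distinct_conv_nth)
  qed
  have degrees: "\<And>r. r < m \<Longrightarrow> card {c. c < m \<and> (Ts ! i) r c \<noteq> None} = k"
      "\<And>c. c < m \<Longrightarrow> card {r. r < m \<and> (Ts ! i) r c \<noteq> None} = k"
      "\<And>s. s \<in> S \<Longrightarrow> card {(r, c). r < m \<and> c < m \<and> (Ts ! i) r c = Some s} = k"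
    if "i < \<mu>" for i
    using assms mem[OF that] unfolding homogeneous_latin_trade_def by blast+
  let ?T = "\<lambda>i r c s. r < m \<and> c < m \<and> (Ts ! i) r c = Some s"
  have "face \<mu> k {..<m} ?T"
    unfolding face_def
  proof (intro conjI allI impI ballI)
    fix i r assume i: "i < \<mu>" and r: "r \<in> {..<m}"
    have "{c. c < m \<and> (Ts ! i) r c \<noteq> None} = fst ` {(c, s). ?T i r c s}" using r by force
    moreover have "inj_on fst {(c, s). ?T i r c s}" by (auto simp: inj_on_def)
    then have "card (fst ` {(c, s). ?T i r c s}) = card {(c, s). ?T i r c s}" by (rule card_image)
    ultimately show "card {(c, s). ?T i r c s} = k"
      using degrees(1)[OF i, of r] r by simp
  next
    fix i j r c s assume "i < \<mu>" "j < \<mu>" "?T i r c s"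
    then show "\<exists>s'. ?T j r c s'" using filled by blast
  qed simp
  moreover have "face \<mu> k {..<m} (\<lambda>i c s r. ?T i r c s)"
    unfolding face_def
  proof (intro conjI allI impI ballI)
    fix i c assume i: "i < \<mu>" and c: "c \<in> {..<m}"
    have "{r. r < m \<and> (Ts ! i) r c \<noteq> None} = snd ` {(s, r). ?T i r c s}" using c by force
    moreover have "inj_on snd {(s, r). ?T i r c s}" by (auto simp: inj_on_def)
    then have "card (snd ` {(s, r). ?T i r c s}) = card {(s, r). ?T i r c s}" by (rule card_image)
    ultimately show "card {(s, r). ?T i r c s} = k"
      using degrees(2)[OF i, of c] c by simp
  qed (use col_uniq cols in blast)+
  moreover have "face \<mu> k S (\<lambda>i s r c. ?T i r c s)"
    unfolding face_def
  proof (intro conjI allI impI ballI)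
    fix i s assume "i < \<mu>" and "s \<in> S"
    then show "card {(r, c). ?T i r c s} = k" using degrees(3) by blast
  qed (use row_uniq rows in blast)+
  ultimately show ?thesis
    unfolding trade_def using fin inS disj by blast
qed

section \<open>Latin squares and the empty trade\<close>

text \<open>When every cell is filled, the degree is the number of columns.\<close>

lemma face_if_total:
  assumes "\<And>i x y. i < \<mu> \<Longrightarrow> x \<in> X \<Longrightarrow> y \<in> Y \<Longrightarrow> \<exists>z. T i x y z"
    and uniq: "\<And>i x y z z'. i < \<mu> \<Longrightarrow> T i x y z \<Longrightarrow> T i x y z' \<Longrightarrow> z = z'"
    and supp: "\<And>i x y z. i < \<mu> \<Longrightarrow> T i x y z \<Longrightarrow> x \<in> X \<and> y \<in> Y"
  shows "face \<mu> (card Y) X T"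
  unfolding face_def
proof (intro conjI allI impI ballI)
  fix i x assume i: "i < \<mu>" and x: "x \<in> X"
  have "fst ` {(y, z). T i x y z} = Y" using assms(1)[OF i x] supp[OF i] by force
  moreover have "inj_on fst {(y, z). T i x y z}" using uniq[OF i] by (auto simp: inj_on_def)
  then have "card (fst ` {(y, z). T i x y z}) = card {(y, z). T i x y z}" by (rule card_image)
  ultimately show "card {(y, z). T i x y z} = card Y" by simp
next
  fix i j x y z assume "i < \<mu>" "j < \<mu>" "T i x y z"
  then show "\<exists>z'. T j x y z'" using assms(1)[of j x y] supp[of i x y z] by blast
next
  fix i x y z z' assume "i < \<mu>" "T i x y z" "T i x y z'"
  then show "z = z'" by (rule uniq)
qed

lemma ex_residue:
  fixes m g :: int assumes "0 < m"
  shows "\<exists>z. 0 \<le> z \<and> z < m \<and> m dvd z - g"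
  using assms by (intro exI[of _ "g mod m"]) (simp add: mod_eq_dvd_iff[symmetric])

lemma residue_unique:
  fixes m :: int
  assumes "z \<in> {0..<m}" "z' \<in> {0..<m}" "m dvd a" "m dvd b" "a - b = z - z'"
  shows "z = z'"
proof -
  have "m dvd z - z'" using assms(3-5) dvd_diff by metis
  then show ?thesis using assms(1,2) by (simp add: mod_eq_dvd_iff[symmetric])
qed

text \<open>The arrays \<open>r + c + i\<close> modulo \<open>m\<close>, for \<open>i < \<mu>\<close>, are Latin squares without common entries. The
  congruence is kept as a divisibility of \<open>s - (r + c + i)\<close>, in which every coordinate has
  coefficient \<open>\<plusminus>1\<close> and can be solved for.\<close>

lemma has_trade_full:
  assumes "\<mu> \<le> m"
  shows "has_trade \<mu> m m"
proof -
  let ?Z = "{0..<int m}"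
  define T where "T i r c s \<longleftrightarrow> r \<in> ?Z \<and> c \<in> ?Z \<and> s \<in> ?Z \<and> int m dvd s - (r + c + int i)"
    for i r c s
  have "face \<mu> (card ?Z) ?Z T"
  proof (rule face_if_total)
    fix i r c assume "r \<in> ?Z" "c \<in> ?Z"
    then show "\<exists>s. T i r c s" using ex_residue[of "int m" "r + c + int i"] by (auto simp: T_def)
  next
    fix i r c s s' assume "T i r c s" "T i r c s'"
    then show "s = s'" 
      using residue_unique[of s "int m" s' "s - (r + c + int i)" "s' - (r + c + int i)"]
      unfolding T_def by simp
  qed (auto simp: T_def)
  moreover have "face \<mu> (card ?Z) ?Z (\<lambda>i c s r. T i r c s)"
  proof (rule face_if_total)
    fix i c s assume "c \<in> ?Z" "s \<in> ?Z"
    moreover obtain r where "0 \<le> r" "r < int m" "int m dvd r - (s - c - int i)"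
      using ex_residue[of "int m" "s - c - int i"] \<open>c \<in> ?Z\<close> by force
    moreover from this(3) have "int m dvd s - (r + c + int i)"
      by (subst dvd_minus_iff[symmetric]) (simp add: algebra_simps)
    ultimately show "\<exists>r. T i r c s" by (auto simp: T_def)
  next
    fix i c s r r' assume "T i r c s" "T i r' c s"
    then show "r = r'" 
      using residue_unique[of r "int m" r' "s - (r' + c + int i)" "s - (r + c + int i)"]
      unfolding T_def by simp
  qed (auto simp: T_def)
  moreover have "face \<mu> (card ?Z) ?Z (\<lambda>i s r c. T i r c s)"
  proof (rule face_if_total)
    fix i s r assume "s \<in> ?Z" "r \<in> ?Z"
    moreover obtain c where "0 \<le> c" "c < int m" "int m dvd c - (s - r - int i)"
      using ex_residue[of "int m" "s - r - int i"] \<open>r \<in> ?Z\<close> by force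
    moreover from this(3) have "int m dvd s - (r + c + int i)"
      by (subst dvd_minus_iff[symmetric]) (simp add: algebra_simps)
    ultimately show "\<exists>c. T i r c s" by (auto simp: T_def)
  next
    fix i s r c c' assume "T i r c s" "T i r c' s"
    then show "c = c'" 
      using residue_unique[of c "int m" c' "s - (r + c' + int i)" "s - (r + c + int i)"]
      unfolding T_def by simp
  qed (auto simp: T_def)
  moreover have "i = j" if "i < \<mu>" "j < \<mu>" "T i r c s" "T j r c s" for i j r c s
  proof -
    have "int j = int i"
      by (rule residue_unique[of _ "int m" _ "s - (r + c + int i)" "s - (r + c + int j)"])
        (use that assms in \<open>auto simp: T_def\<close>)
    then show ?thesis by simp
  qed
  ultimately have "trade \<mu> m ?Z ?Z ?Z T"
    unfolding trade_def by (auto simp: T_def)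
  then show ?thesis by (rule has_tradeI) simp_all
qed

lemma has_trade_empty: "has_trade \<mu> 0 m"
  unfolding has_trade_def
  by (rule exI[of _ "\<lambda>_ _ _ _. False"]) (simp add: trade_def face_def)

section \<open>Substituting trades into the cells of a square\<close>

text \<open>The index set \<open>P\<close> consists of blocks; block \<open>b\<close> occupies the rows of class \<open>p b\<close>, the columns of
  class \<open>q b\<close> and the symbols of class \<open>w b\<close>, and carries a trade of degree \<open>\<kappa> b\<close>. A row meets
  each column class in at most one block, so the degrees of the blocks on it add up.\<close>

lemma face_blowup:
  assumes fin: "finite P"
    and inj: "\<And>b b'. b \<in> P \<Longrightarrow> b' \<in> P \<Longrightarrow> p b = p b' \<Longrightarrow> q b = q b' \<Longrightarrow> b = b'"
    and face: "\<And>b. b \<in> P \<Longrightarrow> face \<mu> (\<kappa> b) (X (p b)) (T b)"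
    and supp: "\<And>b i x y z. b \<in> P \<Longrightarrow> i < \<mu> \<Longrightarrow> T b i x y z \<Longrightarrow> y \<in> X (q b) \<and> z \<in> X (w b)"
    and finX: "\<And>b. b \<in> P \<Longrightarrow> finite (X (q b)) \<and> finite (X (w b))"
    and deg: "\<And>x. x \<in> I \<Longrightarrow> (\<Sum>b | b \<in> P \<and> p b = x. \<kappa> b) = k"
  shows "face \<mu> k (Sigma I X) (\<lambda>i x y z. \<exists>b\<in>P. p b = fst x \<and> q b = fst y \<and> w b = fst z \<and>
    T b i (snd x) (snd y) (snd z))"
  unfolding face_def
proof (intro conjI allI impI ballI)
  fix i x y z z' assume i: "i < \<mu>"
    and "\<exists>b\<in>P. p b = fst x \<and> q b = fst y \<and> w b = fst z \<and> T b i (snd x) (snd y) (snd z)"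
    and "\<exists>b\<in>P. p b = fst x \<and> q b = fst y \<and> w b = fst z' \<and> T b i (snd x) (snd y) (snd z')"
  then obtain b b' where b: "b \<in> P" "p b = fst x" "q b = fst y" "w b = fst z" "T b i (snd x) (snd y) (snd z)"
    and b': "b' \<in> P" "p b' = fst x" "q b' = fst y" "w b' = fst z'" "T b' i (snd x) (snd y) (snd z')"
    by blast
  have "b = b'" using inj b b' by simp
  then show "z = z'" using b b' face_unique[OF face i] by (metis prod_eqI)
next
  fix i j x y z assume i: "i < \<mu>" "j < \<mu>"
    and "\<exists>b\<in>P. p b = fst x \<and> q b = fst y \<and> w b = fst z \<and> T b i (snd x) (snd y) (snd z)"
  then obtain b where b: "b \<in> P" "p b = fst x" "q b = fst y" "T b i (snd x) (snd y) (snd z)"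
    by blast
  then obtain z' where "T b j (snd x) (snd y) z'" using face_exchange[OF face i] by blast
  then show "\<exists>z. \<exists>b\<in>P. p b = fst x \<and> q b = fst y \<and> w b = fst z \<and> T b j (snd x) (snd y) (snd z)"
    using b by (intro exI[of _ "(w b, z')"]) auto
next
  fix i x assume i: "i < \<mu>" and x: "x \<in> Sigma I X"
  let ?B = "{b. b \<in> P \<and> p b = fst x}"
  let ?N = "\<lambda>b. {(y, z). T b i (snd x) y z}"
  let ?tag = "\<lambda>b (y, z). ((q b, y), (w b, z))"
  have card: "card (?tag b ` ?N b) = \<kappa> b" and finN: "finite (?tag b ` ?N b)" if "b \<in> ?B" for b
  proof -
    have "inj_on (?tag b) (?N b)" by (auto simp: inj_on_def)
    then show "card (?tag b ` ?N b) = \<kappa> b"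
      using face_degree[OF face i, of b "snd x"] that x by (auto simp: card_image)
    have "?N b \<subseteq> X (q b) \<times> X (w b)" using supp[of b i] i that by blast
    then show "finite (?tag b ` ?N b)" 
      using finX[of b] that finite_subset[of "?N b" "X (q b) \<times> X (w b)"] by blast
  qed
  have "{(y, z). \<exists>b\<in>P. p b = fst x \<and> q b = fst y \<and> w b = fst z \<and> T b i (snd x) (snd y) (snd z)}
      = (\<Union>b\<in>?B. ?tag b ` ?N b)"
    by force
  also have "card \<dots> = (\<Sum>b\<in>?B. card (?tag b ` ?N b))"
  proof (rule card_UN_disjoint)
    show "\<forall>b\<in>?B. \<forall>b'\<in>?B. b \<noteq> b' \<longrightarrow> ?tag b ` ?N b \<inter> ?tag b' ` ?N b' = {}"
      using inj by fastforce
  qed (use fin finN in auto)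
  also have "\<dots> = (\<Sum>b\<in>?B. \<kappa> b)" using card by (intro sum.cong) auto
  also have "\<dots> = k" using deg x by auto
  finally show "card {(y, z). \<exists>b\<in>P. p b = fst x \<and> q b = fst y \<and> w b = fst z \<and>
    T b i (snd x) (snd y) (snd z)} = k" .
qed

lemma trade_blowup:
  assumes fin: "finite P" "finite I"
    and coords: "\<And>b. b \<in> P \<Longrightarrow> p b \<in> I \<and> q b \<in> I \<and> w b \<in> I"
    and inj: "inj_on (\<lambda>b. (p b, q b)) P" "inj_on (\<lambda>b. (q b, w b)) P" "inj_on (\<lambda>b. (w b, p b)) P"
    and trade: "\<And>b. b \<in> P \<Longrightarrow> trade \<mu> (\<kappa> b) (X (p b)) (X (q b)) (X (w b)) (T b)"
    and deg: "\<And>x. x \<in> I \<Longrightarrow> (\<Sum>b | b \<in> P \<and> p b = x. \<kappa> b) = k"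
      "\<And>x. x \<in> I \<Longrightarrow> (\<Sum>b | b \<in> P \<and> q b = x. \<kappa> b) = k"
      "\<And>x. x \<in> I \<Longrightarrow> (\<Sum>b | b \<in> P \<and> w b = x. \<kappa> b) = k"
    and finX: "\<And>x. x \<in> I \<Longrightarrow> finite (X x)"
  shows "trade \<mu> k (Sigma I X) (Sigma I X) (Sigma I X)
    (\<lambda>i x y z. \<exists>b\<in>P. p b = fst x \<and> q b = fst y \<and> w b = fst z \<and> T b i (snd x) (snd y) (snd z))"
    (is "trade _ _ _ _ _ ?T")
proof -
  have F: "face \<mu> (\<kappa> b) (X (p b)) (T b)" "face \<mu> (\<kappa> b) (X (q b)) (\<lambda>i y z x. T b i x y z)"
    "face \<mu> (\<kappa> b) (X (w b)) (\<lambda>i z x y. T b i x y z)" if "b \<in> P" for b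
    using trade[OF that] unfolding trade_def by blast+
  have supp: "x \<in> X (p b) \<and> y \<in> X (q b) \<and> z \<in> X (w b)" if "b \<in> P" "i < \<mu>" "T b i x y z" for b i x y z
    using trade[OF that(1)] that(2,3) unfolding trade_def by blast
  have 1: "face \<mu> k (Sigma I X) ?T"
    by (rule face_blowup[where \<kappa> = \<kappa>])
      (use fin inj F supp coords finX deg in \<open>auto simp: inj_on_def\<close>)
  have 2: "face \<mu> k (Sigma I X) (\<lambda>i y z x. \<exists>b\<in>P. q b = fst y \<and> w b = fst z \<and> p b = fst x \<and>
      T b i (snd x) (snd y) (snd z))"
    by (rule face_blowup[where \<kappa> = \<kappa> and T = "\<lambda>b i y z x. T b i x y z"])
      (use fin inj F supp coords finX deg in \<open>auto simp: inj_on_def\<close>)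
  have 3: "face \<mu> k (Sigma I X) (\<lambda>i z x y. \<exists>b\<in>P. w b = fst z \<and> p b = fst x \<and> q b = fst y \<and>
      T b i (snd x) (snd y) (snd z))"
    by (rule face_blowup[where \<kappa> = \<kappa> and T = "\<lambda>b i z x y. T b i x y z"])
      (use fin inj F supp coords finX deg in \<open>auto simp: inj_on_def\<close>)
  have rot: "q b = y \<and> w b = z \<and> p b = x \<and> A \<longleftrightarrow> p b = x \<and> q b = y \<and> w b = z \<and> A"
    "w b = z \<and> p b = x \<and> q b = y \<and> A \<longleftrightarrow> p b = x \<and> q b = y \<and> w b = z \<and> A" for b x y z A
    by blast+
  have 2: "face \<mu> k (Sigma I X) (\<lambda>i y z x. ?T i x y z)"
    using 2 unfolding rot(1) .
  have 3: "face \<mu> k (Sigma I X) (\<lambda>i z x y. ?T i x y z)"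
    using 3 unfolding rot(2) .
  have "i = j" if ij: "i < \<mu>" "j < \<mu>" and T: "?T i x y z" "?T j x y z" for i j x y z
  proof -
    obtain b b' where b: "b \<in> P" "p b = fst x" "q b = fst y" "T b i (snd x) (snd y) (snd z)"
      and b': "b' \<in> P" "p b' = fst x" "q b' = fst y" "T b' j (snd x) (snd y) (snd z)"
      using T by blast
    have "b = b'" using inj(1) b b' by (auto simp: inj_on_def)
    then show ?thesis using trade[OF b(1)] b b' ij unfolding trade_def by blast
  qed
  moreover have "x \<in> Sigma I X \<and> y \<in> Sigma I X \<and> z \<in> Sigma I X" if "i < \<mu>" "?T i x y z" for i x y z
    using that coords supp by (metis mem_Sigma_iff prod.collapse)
  ultimately show ?thesis
    unfolding trade_def using 1 2 3 fin finX by blast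
qed

text \<open>The squares are indexed by \<open>x\<close> and \<open>t\<close>. Below, \<open>x\<close> serves as a class of rows, \<open>q x t\<close> as a class
  of columns and \<open>w x t\<close> as a class of symbols, while \<open>t\<close> is the entry of an orthogonal mate of the
  Latin square with rows \<open>x\<close>, columns \<open>q x t\<close> and symbols \<open>w x t\<close>.\<close>

definition orthogonal_squares :: "nat \<Rightarrow> (nat \<Rightarrow> nat \<Rightarrow> nat) \<Rightarrow> (nat \<Rightarrow> nat \<Rightarrow> nat) \<Rightarrow> bool" where
  "orthogonal_squares l q w \<longleftrightarrow>
     (\<forall>x<l. \<forall>t<l. q x t < l \<and> w x t < l) \<and>
     (\<forall>x<l. inj_on (q x) {..<l} \<and> inj_on (w x) {..<l}) \<and>
     (\<forall>t<l. inj_on (\<lambda>x. q x t) {..<l} \<and> inj_on (\<lambda>x. w x t) {..<l}) \<and>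
     inj_on (\<lambda>b. (q (fst b) (snd b), w (fst b) (snd b))) ({..<l} \<times> {..<l})"

text \<open>A row class, a column class or a symbol class meets each value of \<open>t\<close> exactly once.\<close>

lemma sum_over_entry:
  fixes d :: "nat \<Rightarrow> nat"
  assumes "\<And>x t. x < l \<Longrightarrow> t < l \<Longrightarrow> \<phi> x t < l"
    and inj: "\<And>t. t < l \<Longrightarrow> inj_on (\<lambda>x. \<phi> x t) {..<l}" and y: "y < l"
  shows "(\<Sum>b | b \<in> {..<l} \<times> {..<l} \<and> \<phi> (fst b) (snd b) = y. d (snd b)) = (\<Sum>t<l. d t)"
proof -
  let ?B = "{b. b \<in> {..<l} \<times> {..<l} \<and> \<phi> (fst b) (snd b) = y}"
  have "bij_betw snd ?B {..<l}"
    unfolding bij_betw_def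
  proof
    show "inj_on snd ?B" using inj by (auto simp: inj_on_def)
    show "snd ` ?B = {..<l}"
    proof (intro equalityI subsetI)
      fix t assume t: "t \<in> {..<l}"
      have "(\<lambda>x. \<phi> x t) ` {..<l} = {..<l}"
        using endo_inj_surj[of "{..<l}" "\<lambda>x. \<phi> x t"] assms(1) inj t by auto
      then obtain x where "x < l" "\<phi> x t = y" using y by (metis imageE lessThan_iff)
      then show "t \<in> snd ` ?B" using t by force
    qed auto
  qed
  then show ?thesis by (rule sum.reindex_bij_betw)
qed

lemma has_trade_blowup:
  assumes orth: "orthogonal_squares l q w" and t: "\<And>t. t < l \<Longrightarrow> has_trade \<mu> (d t) n"
  shows "has_trade \<mu> (\<Sum>t<l. d t) (l * n)"
proof -
  let ?P = "{..<l} \<times> {..<l}"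
  obtain T :: "nat \<Rightarrow> nat \<Rightarrow> nat \<Rightarrow> nat \<Rightarrow> nat \<Rightarrow> bool"
    where T: "\<And>t. t < l \<Longrightarrow> trade \<mu> (d t) {..<n} {..<n} {..<n} (T t)"
    using t unfolding has_trade_def by metis
  have O: "\<And>x t. x < l \<Longrightarrow> t < l \<Longrightarrow> q x t < l" "\<And>x t. x < l \<Longrightarrow> t < l \<Longrightarrow> w x t < l"
    "\<And>x. x < l \<Longrightarrow> inj_on (q x) {..<l}" "\<And>x. x < l \<Longrightarrow> inj_on (w x) {..<l}"
    "\<And>t. t < l \<Longrightarrow> inj_on (\<lambda>x. q x t) {..<l}" "\<And>t. t < l \<Longrightarrow> inj_on (\<lambda>x. w x t) {..<l}"
    "inj_on (\<lambda>b. (q (fst b) (snd b), w (fst b) (snd b))) ?P"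
    using orth unfolding orthogonal_squares_def by blast+
  have "trade \<mu> (\<Sum>t<l. d t) (Sigma {..<l} (\<lambda>_. {..<n})) (Sigma {..<l} (\<lambda>_. {..<n})) (Sigma {..<l} (\<lambda>_. {..<n}))
    (\<lambda>i x y z. \<exists>b\<in>?P. fst b = fst x \<and> q (fst b) (snd b) = fst y \<and> w (fst b) (snd b) = fst z \<and>
      T (snd b) i (snd x) (snd y) (snd z))"
  proof (rule trade_blowup[where \<kappa> = "\<lambda>b. d (snd b)"])
    show "inj_on (\<lambda>b. (fst b, q (fst b) (snd b))) ?P" using O(3) by (auto simp: inj_on_def)
    show "inj_on (\<lambda>b. (w (fst b) (snd b), fst b)) ?P" using O(4) by (auto simp: inj_on_def)
    show "(\<Sum>b | b \<in> ?P \<and> fst b = x. d (snd b)) = (\<Sum>t<l. d t)" if "x \<in> {..<l}" for x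
      using sum_over_entry[of l "\<lambda>x t. x" x d] that by simp
    show "(\<Sum>b | b \<in> ?P \<and> q (fst b) (snd b) = x. d (snd b)) = (\<Sum>t<l. d t)" if "x \<in> {..<l}" for x
      using that by (intro sum_over_entry O) auto
    show "(\<Sum>b | b \<in> ?P \<and> w (fst b) (snd b) = x. d (snd b)) = (\<Sum>t<l. d t)" if "x \<in> {..<l}" for x
      using that by (intro sum_over_entry O) auto
  qed (use O T in auto)
  then show ?thesis by (rule has_tradeI) simp_all
qed

text \<open>A block diagonal sum: two blocks, which share no class.\<close>

lemma has_trade_add:
  assumes "has_trade \<mu> k m" "has_trade \<mu> k n"
  shows "has_trade \<mu> k (m + n)"
proof -
  obtain T T' :: "nat \<Rightarrow> nat \<Rightarrow> nat \<Rightarrow> nat \<Rightarrow> bool"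
    where T: "trade \<mu> k {..<m} {..<m} {..<m} T" "trade \<mu> k {..<n} {..<n} {..<n} T'"
    using assms unfolding has_trade_def by blast
  let ?X = "\<lambda>b. {..<if b then m else n}"
  have card: "card (Sigma UNIV ?X) = m + n"
    unfolding UNIV_bool by (subst card_SigmaI) auto
  have "trade \<mu> k (Sigma UNIV ?X) (Sigma UNIV ?X) (Sigma UNIV ?X)
    (\<lambda>i x y z. \<exists>b\<in>UNIV. b = fst x \<and> b = fst y \<and> b = fst z \<and> (if b then T else T') i (snd x) (snd y) (snd z))"
    by (rule trade_blowup[where \<kappa> = "\<lambda>_. k"]) (use T in \<open>auto simp: inj_on_def\<close>)
  from has_tradeI[OF this card card card] show ?thesis .
qed

text \<open>The coefficients 1 and 2 of \<open>x\<close> and their difference are units modulo an odd number.\<close>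

lemma orthogonal_squares_odd:
  assumes "odd l"
  shows "orthogonal_squares l (\<lambda>x t. (x + t) mod l) (\<lambda>x t. (2 * x + t) mod l)"
proof -
  have cancel: "a = b" if "a < l" "b < l" "int l dvd e * (int a - int b)" "coprime (int l) e" for a b e
  proof -
    have "int l dvd int a - int b"
      using that(3,4) by (simp add: coprime_dvd_mult_right_iff)
    then show ?thesis using residue_unique[of "int a" "int l" "int b" "int a - int b" 0] that by simp
  qed
  have two: "coprime (int l) 2" using assms by simp
  have eq: "int l dvd int a - int b" if "a mod l = b mod l" for a b
    using that by (metis mod_eq_dvd_iff zmod_int)
  show ?thesis
    unfolding orthogonal_squares_def
  proof (intro conjI allI impI inj_onI)
    fix x t assume "x < l" "t < l"
    then show "(x + t) mod l < l" "(2 * x + t) mod l < l" by simp_all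
  next
    fix x t t' assume "t \<in> {..<l}" "t' \<in> {..<l}" "(x + t) mod l = (x + t') mod l"
    then show "t = t'" using cancel[of t t' 1] eq[of "x + t" "x + t'"] by simp
  next
    fix x t t' assume "t \<in> {..<l}" "t' \<in> {..<l}" "(2 * x + t) mod l = (2 * x + t') mod l"
    then show "t = t'" using cancel[of t t' 1] eq[of "2 * x + t" "2 * x + t'"] by simp
  next
    fix t x x' assume "x \<in> {..<l}" "x' \<in> {..<l}" "(x + t) mod l = (x' + t) mod l"
    then show "x = x'" using cancel[of x x' 1] eq[of "x + t" "x' + t"] by simp
  next
    fix t x x' assume "x \<in> {..<l}" "x' \<in> {..<l}" "(2 * x + t) mod l = (2 * x' + t) mod l"
    then show "x = x'" using cancel[OF _ _ _ two, of x x'] eq[of "2 * x + t" "2 * x' + t"] by (simp add: algebra_simps)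
  next
    fix b b' :: "nat \<times> nat" assume "b \<in> {..<l} \<times> {..<l}" "b' \<in> {..<l} \<times> {..<l}"
      and "((fst b + snd b) mod l, (2 * fst b + snd b) mod l) =
        ((fst b' + snd b') mod l, (2 * fst b' + snd b') mod l)"
    moreover obtain x t x' t' where [simp]: "b = (x, t)" "b' = (x', t')" by fastforce
    ultimately have lt: "x < l" "t < l" "x' < l" "t' < l"
      and "(x + t) mod l = (x' + t') mod l" "(2 * x + t) mod l = (2 * x' + t') mod l"
      by auto
    then have e: "int l dvd int (x + t) - int (x' + t')" "int l dvd int (2 * x + t) - int (2 * x' + t')"
      using eq by blast+
    have "x = x'" using cancel[of x x' 1] lt dvd_diff[OF e(2,1)] by simp
    moreover have "t = t'" using cancel[of t t' 1] lt e(1) \<open>x = x'\<close> by simp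
    ultimately show "b = b'" by simp
  qed
qed

text \<open>The tables are \<open>x + t\<close> and \<open>\<omega> * x + t\<close> over the field with four elements, whose elements
  \<open>0, 1, \<omega>, \<omega> + 1\<close> are numbered 0 to 3.\<close>

lemma orthogonal_squares_4:
  "orthogonal_squares 4
     (\<lambda>x t. [[0, 1, 2, 3], [1, 0, 3, 2], [2, 3, 0, 1], [3, 2, 1, 0]] ! x ! t)
     (\<lambda>x t. [[0, 1, 2, 3], [2, 3, 0, 1], [3, 2, 1, 0], [1, 0, 3, 2]] ! x ! t)"
proof -
  have 4: "{..<4 :: nat} = {0, 1, 2, 3}" by auto
  show ?thesis
    unfolding orthogonal_squares_def lessThan_iff[symmetric] Ball_def[symmetric] 4
    by simp
qed

section \<open>Base rows developed cyclically\<close>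

text \<open>A pair \<open>(c, a)\<close> stands for a symbol \<open>a\<close> in column \<open>c\<close> of row 0. Up to sign, its three views are
  the differences of the coordinates of the triple \<open>(0, c, a)\<close>, which are unchanged
  when the triple is translated along the diagonal.\<close>

definition views :: "(int \<times> int \<Rightarrow> int) set" where
  "views = {fst, snd, \<lambda>b. snd b - fst b}"

text \<open>Since \<open>x mod 0 = x\<close>, taking \<open>m = 0\<close> gives base rows over the integers.\<close>

definition base_row :: "nat \<Rightarrow> nat \<Rightarrow> int \<Rightarrow> (nat \<Rightarrow> (int \<times> int) set) \<Rightarrow> bool" where
  "base_row \<mu> k m B \<longleftrightarrow>
     (\<forall>i<\<mu>. finite (B i) \<and> card (B i) = k) \<and>
     (\<forall>\<phi>\<in>views. \<forall>i<\<mu>. inj_on (\<lambda>b. \<phi> b mod m) (B i)) \<and>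
     (\<forall>\<phi>\<in>views. \<forall>i<\<mu>. \<forall>j<\<mu>. (\<lambda>b. \<phi> b mod m) ` B i = (\<lambda>b. \<phi> b mod m) ` B j) \<and>
     (\<forall>i<\<mu>. \<forall>j<\<mu>. \<forall>b\<in>B i. \<forall>b'\<in>B j.
        fst b mod m = fst b' mod m \<longrightarrow> snd b mod m = snd b' mod m \<longrightarrow> i = j)"

lemma base_row_card: "base_row \<mu> k m B \<Longrightarrow> i < \<mu> \<Longrightarrow> finite (B i) \<and> card (B i) = k"
  by (simp add: base_row_def)

lemma base_row_inj: "base_row \<mu> k m B \<Longrightarrow> \<phi> \<in> views \<Longrightarrow> i < \<mu> \<Longrightarrow> inj_on (\<lambda>b. \<phi> b mod m) (B i)"
  by (simp add: base_row_def)

lemma base_row_image: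
  assumes "base_row \<mu> k m B" "\<phi> \<in> views" "i < \<mu>" "j < \<mu>"
  shows "(\<lambda>b. \<phi> b mod m) ` B i = (\<lambda>b. \<phi> b mod m) ` B j"
proof -
  have "\<forall>\<phi>\<in>views. \<forall>i<\<mu>. \<forall>j<\<mu>. (\<lambda>b. \<phi> b mod m) ` B i = (\<lambda>b. \<phi> b mod m) ` B j"
    using assms(1) unfolding base_row_def by (elim conjE)
  from this[rule_format, OF assms(2-4)] show ?thesis .
qed

lemma base_row_disjoint:
  assumes "base_row \<mu> k m B" "i < \<mu>" "j < \<mu>" "b \<in> B i" "b' \<in> B j"
    and "fst b mod m = fst b' mod m" "snd b mod m = snd b' mod m"
  shows "i = j"
proof -
  have "\<forall>i<\<mu>. \<forall>j<\<mu>. \<forall>b\<in>B i. \<forall>b'\<in>B j.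
      fst b mod m = fst b' mod m \<longrightarrow> snd b mod m = snd b' mod m \<longrightarrow> i = j"
    using assms(1) unfolding base_row_def by (elim conjE)
  from this[rule_format, OF assms(2-7)] show ?thesis .
qed

text \<open>A pair of coordinates \<open>(x, y)\<close> of a translate determines the difference \<open>y - x\<close>, which determines
  the untranslated triple by injectivity, and then the translation. The functions
  \<open>p\<close>, \<open>q\<close>, \<open>w\<close> are kept abstract so that the three faces are instances.\<close>

lemma face_develop:
  fixes p q w :: "'b \<Rightarrow> int" and m :: int
  assumes m: "0 < m"
    and card: "\<And>i. i < \<mu> \<Longrightarrow> card (B i) = k"
    and inj: "\<And>i. i < \<mu> \<Longrightarrow> inj_on (\<lambda>b. (q b - p b) mod m) (B i)"
    and image: "\<And>i j. i < \<mu> \<Longrightarrow> j < \<mu> \<Longrightarrow>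
      (\<lambda>b. (q b - p b) mod m) ` B i = (\<lambda>b. (q b - p b) mod m) ` B j"
  shows "face \<mu> k {0..<m} (\<lambda>i x y z. \<exists>b\<in>B i. \<exists>t.
    x = (p b + t) mod m \<and> y = (q b + t) mod m \<and> z = (w b + t) mod m)"
  unfolding face_def
proof (intro conjI allI impI ballI)
  show "z = z'" if i: "i < \<mu>" and e: "\<exists>b\<in>B i. \<exists>t. x = (p b + t) mod m \<and> y = (q b + t) mod m \<and> z = (w b + t) mod m"
    and e': "\<exists>b\<in>B i. \<exists>t. x = (p b + t) mod m \<and> y = (q b + t) mod m \<and> z' = (w b + t) mod m" for i x y z z'
  proof -
    obtain b t where b: "b \<in> B i" "x = (p b + t) mod m" "y = (q b + t) mod m" "z = (w b + t) mod m"
      using e by blast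
    obtain b' t' where b': "b' \<in> B i" "x = (p b' + t') mod m" "y = (q b' + t') mod m"
        "z' = (w b' + t') mod m"
      using e' by blast
    have "((q b + t) - (p b + t)) mod m = ((q b' + t') - (p b' + t')) mod m"
      using b b' by (intro mod_diff_cong) simp_all
    then have "b = b'" using inj[OF i] b(1) b'(1) by (auto simp: inj_on_def)
    then have "((p b + t) - p b) mod m = ((p b + t') - p b) mod m"
      using b b' by (intro mod_diff_cong) simp_all
    then have "t mod m = t' mod m" by simp
    then have "(w b + t) mod m = (w b + t') mod m" by (intro mod_add_cong) simp_all
    then show "z = z'" using b b' \<open>b = b'\<close> by simp
  qed
  show "\<exists>z. \<exists>b\<in>B j. \<exists>t. x = (p b + t) mod m \<and> y = (q b + t) mod m \<and> z = (w b + t) mod m"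
    if ij: "i < \<mu>" "j < \<mu>"
      and e: "\<exists>b\<in>B i. \<exists>t. x = (p b + t) mod m \<and> y = (q b + t) mod m \<and> z = (w b + t) mod m" for i j x y z
  proof -
    obtain b t where b: "b \<in> B i" "x = (p b + t) mod m" "y = (q b + t) mod m" using e by blast
    obtain b' where b': "b' \<in> B j" "(q b' - p b') mod m = (q b - p b) mod m"
      using image[OF ij] b(1) by (metis (mono_tags, lifting) image_iff)
    have "((q b' - p b') + (p b + t)) mod m = ((q b - p b) + (p b + t)) mod m"
      using b' by (intro mod_add_cong) simp_all
    then have "y = (q b' + (p b + t - p b')) mod m" using b by (simp add: algebra_simps)
    moreover have "x = (p b' + (p b + t - p b')) mod m" using b by simp
    ultimately show ?thesis using b' by blast
  qed
  show "card {(y, z). \<exists>b\<in>B i. \<exists>t. x = (p b + t) mod m \<and> y = (q b + t) mod m \<and> z = (w b + t) mod m} = k"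
    if i: "i < \<mu>" and x: "x \<in> {0..<m}" for i x
  proof -
    let ?g = "\<lambda>b. ((q b - p b + x) mod m, (w b - p b + x) mod m)"
    have "{(y, z). \<exists>b\<in>B i. \<exists>t. x = (p b + t) mod m \<and> y = (q b + t) mod m \<and> z = (w b + t) mod m} = ?g ` B i"
    proof (intro equalityI subsetI)
      fix v assume "v \<in> {(y, z). \<exists>b\<in>B i. \<exists>t. x = (p b + t) mod m \<and> y = (q b + t) mod m \<and> z = (w b + t) mod m}"
      then obtain b t where b: "b \<in> B i" "x = (p b + t) mod m" "v = ((q b + t) mod m, (w b + t) mod m)"
        by blast
      have "(u + t) mod m = (u - p b + x) mod m" for u
        unfolding b(2) by (simp add: mod_simps)
      then show "v \<in> ?g ` B i" using b by blast
    next
      fix v assume "v \<in> ?g ` B i"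
      then obtain b where b: "b \<in> B i" "v = ?g b" by blast
      have "x = (p b + (x - p b)) mod m" using x by simp
      moreover have "v = ((q b + (x - p b)) mod m, (w b + (x - p b)) mod m)"
        using b(2) by (simp add: algebra_simps)
      ultimately show "v \<in> {(y, z). \<exists>b\<in>B i. \<exists>t. x = (p b + t) mod m \<and> y = (q b + t) mod m \<and> z = (w b + t) mod m}"
        using b(1) by blast
    qed
    moreover have "inj_on ?g (B i)"
    proof (rule inj_onI)
      fix b b' assume b: "b \<in> B i" "b' \<in> B i" "?g b = ?g b'"
      then have "(q b - p b + x - x) mod m = (q b' - p b' + x - x) mod m"
        by (intro mod_diff_cong) simp_all
      then show "b = b'" using inj[OF i] b by (auto simp: inj_on_def)
    qed
    then have "card (?g ` B i) = card (B i)" by (rule card_image)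
    ultimately show ?thesis using card[OF i] by simp
  qed
qed

lemma has_trade_develop:
  assumes B: "base_row \<mu> k (int m) B" and m: "0 < m"
  shows "has_trade \<mu> k m"
proof -
  let ?T = "\<lambda>i r c s. \<exists>b\<in>B i. \<exists>t.
    r = (0 + t) mod int m \<and> c = (fst b + t) mod int m \<and> s = (snd b + t) mod int m"
  note inj = base_row_inj[OF B] and image = base_row_image[OF B]
  have card: "\<And>i. i < \<mu> \<Longrightarrow> card (B i) = k" using base_row_card[OF B] by blast
  have views: "fst \<in> views" "snd \<in> views" "(\<lambda>b. snd b - fst b) \<in> views"
    by (simp_all add: views_def)
  have 1: "face \<mu> k {0..<int m} ?T"
  proof (rule face_develop)
    show "(\<lambda>b. (fst b - 0) mod int m) ` B i = (\<lambda>b. (fst b - 0) mod int m) ` B j"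
      if "i < \<mu>" "j < \<mu>" for i j
      using image[OF views(1) that] by simp
  qed (use m card inj[OF views(1)] in auto)
  have 2: "face \<mu> k {0..<int m} (\<lambda>i c s r. \<exists>b\<in>B i. \<exists>t.
      c = (fst b + t) mod int m \<and> s = (snd b + t) mod int m \<and> r = (0 + t) mod int m)"
    by (rule face_develop) (use m card in simp, use card in simp, erule inj[OF views(3)], erule (1) image[OF views(3)])
  have 3: "face \<mu> k {0..<int m} (\<lambda>i s r c. \<exists>b\<in>B i. \<exists>t.
      s = (snd b + t) mod int m \<and> r = (0 + t) mod int m \<and> c = (fst b + t) mod int m)"
  proof (rule face_develop)
    have neg: "(0 - a) mod int m = (- (a mod int m)) mod int m" for a by (simp add: mod_simps)
    show "inj_on (\<lambda>b. (0 - snd b) mod int m) (B i)" if "i < \<mu>" for i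
    proof (rule inj_onI)
      fix b b' assume b: "b \<in> B i" "b' \<in> B i" "(0 - snd b) mod int m = (0 - snd b') mod int m"
      have "(0 - (0 - snd b)) mod int m = (0 - (0 - snd b')) mod int m"
        by (rule mod_diff_cong) (use b in simp_all)
      then show "b = b'" using inj[OF views(2) that] b by (auto simp: inj_on_def)
    qed
    show "(\<lambda>b. (0 - snd b) mod int m) ` B i = (\<lambda>b. (0 - snd b) mod int m) ` B j"
      if "i < \<mu>" "j < \<mu>" for i j
    proof -
      have "(\<lambda>b. (0 - snd b) mod int m) ` B i = (\<lambda>v. (- v) mod int m) ` (\<lambda>b. snd b mod int m) ` B i" for i
        unfolding neg by (simp add: image_image)
      then show ?thesis using image[OF views(2) that] by simp
    qed
  qed (use m card in auto)
  have supp: "0 \<le> r \<and> r < int m \<and> 0 \<le> c \<and> c < int m \<and> 0 \<le> s \<and> s < int m"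
    if "?T i r c s" for i r c s
    using that m by auto
  have disj: "i = j" if ij: "i < \<mu>" "j < \<mu>" and T: "?T i r c s" "?T j r c s" for i j r c s
  proof -
    obtain b t where b: "b \<in> B i" "r = t mod int m" "c = (fst b + t) mod int m" "s = (snd b + t) mod int m"
      using T(1) by auto
    obtain b' t' where b': "b' \<in> B j" "r = t' mod int m" "c = (fst b' + t') mod int m" "s = (snd b' + t') mod int m"
      using T(2) by auto
    have "(fst b + t - t) mod int m = (fst b' + t' - t') mod int m"
      by (rule mod_diff_cong) (use b b' in simp_all)
    moreover have "(snd b + t - t) mod int m = (snd b' + t' - t') mod int m"
      by (rule mod_diff_cong) (use b b' in simp_all)
    ultimately show ?thesis using base_row_disjoint[OF B ij b(1) b'(1)] by simp
  qed
  have rot: "c = (fst b + t) mod int m \<and> s = (snd b + t) mod int m \<and> r = (0 + t) mod int m \<longleftrightarrow>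
      r = (0 + t) mod int m \<and> c = (fst b + t) mod int m \<and> s = (snd b + t) mod int m"
    "s = (snd b + t) mod int m \<and> r = (0 + t) mod int m \<and> c = (fst b + t) mod int m \<longleftrightarrow>
      r = (0 + t) mod int m \<and> c = (fst b + t) mod int m \<and> s = (snd b + t) mod int m"
    for r c s t and b :: "int \<times> int"
    by blast+
  have "trade \<mu> k {0..<int m} {0..<int m} {0..<int m} ?T"
    unfolding trade_def
  proof (intro conjI)
    show "\<forall>i<\<mu>. \<forall>r c s. ?T i r c s \<longrightarrow> r \<in> {0..<int m} \<and> c \<in> {0..<int m} \<and> s \<in> {0..<int m}"
      unfolding atLeastLessThan_iff using supp by blast
    show "\<forall>i<\<mu>. \<forall>j<\<mu>. \<forall>r c s. ?T i r c s \<longrightarrow> ?T j r c s \<longrightarrow> i = j"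
      using disj by blast
    show "face \<mu> k {0..<int m} ?T" by (rule 1)
    show "face \<mu> k {0..<int m} (\<lambda>i c s r. ?T i r c s)" using 2 unfolding rot(1) .
    show "face \<mu> k {0..<int m} (\<lambda>i s r c. ?T i r c s)" using 3 unfolding rot(2) .
  qed simp_all
  then show ?thesis by (rule has_tradeI) simp_all
qed

lemma inj_on_mod_window:
  fixes X :: "int set"
  assumes "X \<subseteq> {l..<l + m}"
  shows "inj_on (\<lambda>x. x mod m) X"
proof (rule inj_onI)
  fix x y assume xy: "x \<in> X" "y \<in> X" "x mod m = y mod m"
  have "x - l = y - l"
    by (rule residue_unique[of _ m _ "x - y" 0])
      (use xy assms in \<open>auto simp: mod_eq_dvd_iff\<close>)
  then show "x = y" by simp
qed

definition integer_row :: "nat \<Rightarrow> nat \<Rightarrow> nat \<Rightarrow> (nat \<Rightarrow> (int \<times> int) set) \<Rightarrow> bool" where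
  "integer_row \<mu> k w B \<longleftrightarrow>
     base_row \<mu> k 0 B \<and> (\<forall>\<phi>\<in>views. \<exists>l. \<phi> ` B 0 \<subseteq> {l..<l + int w})"

text \<open>An integer base row survives reduction modulo \<open>m\<close> as soon as \<open>m\<close> does not identify values of the
  same view.\<close>

lemma base_row_reduce:
  assumes B: "base_row \<mu> k 0 B" and inj: "\<And>\<phi>. \<phi> \<in> views \<Longrightarrow> inj_on (\<lambda>x. x mod m) (\<phi> ` B 0)"
  shows "base_row \<mu> k m B"
proof (cases "\<mu> = 0")
  case False
  have image: "\<phi> ` B i = \<phi> ` B j" if "\<phi> \<in> views" "i < \<mu>" "j < \<mu>" for \<phi> i j
    using base_row_image[OF B that] by simp
  have inj': "inj_on (\<lambda>x. x mod m) (\<phi> ` B i)" if "\<phi> \<in> views" "i < \<mu>" for \<phi> i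
    using inj[OF that(1)] image[OF that, of 0] False by simp
  have mem: "\<phi> b \<in> \<phi> ` B 0" if "\<phi> \<in> views" "i < \<mu>" "b \<in> B i" for \<phi> i b
    using image[OF that(1,2), of 0] that(3) False by blast
  show ?thesis
    unfolding base_row_def
  proof (intro conjI ballI allI impI)
    fix \<phi> i assume \<phi>: "\<phi> \<in> views" and i: "i < \<mu>"
    have "inj_on \<phi> (B i)" using base_row_inj[OF B \<phi> i] by simp
    then show "inj_on (\<lambda>b. \<phi> b mod m) (B i)"
      using comp_inj_on[OF _ inj'[OF \<phi> i]] by (simp add: comp_def)
  next
    fix \<phi> i j assume "\<phi> \<in> views" "i < \<mu>" "j < \<mu>"
    then have "(\<lambda>x. x mod m) ` \<phi> ` B i = (\<lambda>x. x mod m) ` \<phi> ` B j" using image by metis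
    then show "(\<lambda>b. \<phi> b mod m) ` B i = (\<lambda>b. \<phi> b mod m) ` B j" by (simp add: image_image)
  next
    fix i j b b' assume ij: "i < \<mu>" "j < \<mu>" and b: "b \<in> B i" "b' \<in> B j"
      and eq: "fst b mod m = fst b' mod m" "snd b mod m = snd b' mod m"
    have v: "fst \<in> views" "snd \<in> views" by (simp_all add: views_def)
    have "fst b = fst b'" "snd b = snd b'"
      using inj_onD[OF inj[OF v(1)] eq(1)] inj_onD[OF inj[OF v(2)] eq(2)]
        mem[OF v(1) ij(1) b(1)] mem[OF v(1) ij(2) b(2)] mem[OF v(2) ij(1) b(1)] mem[OF v(2) ij(2) b(2)]
      by blast+
    then show "i = j" using base_row_disjoint[OF B ij b] by simp
  qed (use base_row_card[OF B] in blast)+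
qed (simp add: base_row_def)

lemma has_trade_integer_row:
  assumes "integer_row \<mu> k w B" "w \<le> m" "0 < m"
  shows "has_trade \<mu> k m"
proof (rule has_trade_develop[OF base_row_reduce])
  show "base_row \<mu> k 0 B" using assms(1) unfolding integer_row_def by blast
  fix \<phi> assume "\<phi> \<in> views"
  then obtain l where "\<phi> ` B 0 \<subseteq> {l..<l + int w}" using assms(1) unfolding integer_row_def by blast
  then have "\<phi> ` B 0 \<subseteq> {l..<l + int m}" using assms(2) by fastforce
  then show "inj_on (\<lambda>x. x mod int m) (\<phi> ` B 0)" by (rule inj_on_mod_window)
qed (use assms in simp)

text \<open>Base rows normalised so that they can be placed side by side: domain and difference set lie in
  \<open>{0..<w}\<close>, hence the image lies in \<open>{0..<2 * w}\<close>.\<close>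

definition stackable :: "nat \<Rightarrow> nat \<Rightarrow> nat \<Rightarrow> bool" where
  "stackable \<mu> k w \<longleftrightarrow> (\<exists>B. base_row \<mu> k 0 B \<and>
     fst ` B 0 \<subseteq> {0..<int w} \<and> (\<lambda>b. snd b - fst b) ` B 0 \<subseteq> {0..<int w})"

lemma base_row_translate:
  assumes B: "base_row \<mu> k 0 B"
  shows "base_row \<mu> k 0 (\<lambda>i. (\<lambda>b. (fst b + x, snd b + y)) ` B i)" (is "base_row _ _ _ (\<lambda>i. ?s ` B i)")
proof -
  have shift: "\<exists>d. \<forall>b. \<phi> (?s b) = \<phi> b + d" if "\<phi> \<in> views" for \<phi>
    using that unfolding views_def by (auto simp: algebra_simps intro: exI[of _ "y - x"])
  have s: "inj ?s" by (auto simp: inj_on_def prod_eq_iff)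
  show ?thesis
    unfolding base_row_def
  proof (intro conjI ballI allI impI)
    fix i assume "i < \<mu>"
    then show "finite (?s ` B i)" "card (?s ` B i) = k"
      using base_row_card[OF B] card_image[OF inj_on_subset[OF s]] by auto
  next
    fix \<phi> i assume \<phi>: "\<phi> \<in> views" and i: "i < \<mu>"
    show "inj_on (\<lambda>b. \<phi> b mod 0) (?s ` B i)"
      using base_row_inj[OF B \<phi> i] shift[OF \<phi>] by (auto simp: inj_on_def)
  next
    fix \<phi> i j assume \<phi>: "\<phi> \<in> views" and ij: "i < \<mu>" "j < \<mu>"
    obtain d where d: "\<And>b. \<phi> (?s b) = \<phi> b + d" using shift[OF \<phi>] by blast
    have "(\<lambda>b. \<phi> b mod 0) ` ?s ` B i = (\<lambda>v. v + d) ` (\<lambda>b. \<phi> b mod 0) ` B i" for i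
      by (simp only: image_image d mod_by_0)
    then show "(\<lambda>b. \<phi> b mod 0) ` ?s ` B i = (\<lambda>b. \<phi> b mod 0) ` ?s ` B j"
      using base_row_image[OF B \<phi> ij] by presburger
  next
    fix i j b b' assume ij: "i < \<mu>" "j < \<mu>" and "b \<in> ?s ` B i" "b' \<in> ?s ` B j"
      and eq: "fst b mod 0 = fst b' mod 0" "snd b mod 0 = snd b' mod 0"
    then obtain a a' where a: "a \<in> B i" "a' \<in> B j" "b = ?s a" "b' = ?s a'" by blast
    then have "fst a mod 0 = fst a' mod 0" "snd a mod 0 = snd a' mod 0" using eq by simp_all
    then show "i = j" by (rule base_row_disjoint[OF B ij a(1,2)])
  qed
qed

lemma base_row_Un:
  assumes B: "base_row \<mu> k 0 B" and B': "base_row \<mu> k' 0 B'"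
    and disj: "\<And>\<phi>. \<phi> \<in> views \<Longrightarrow> \<phi> ` B 0 \<inter> \<phi> ` B' 0 = {}"
  shows "base_row \<mu> (k + k') 0 (\<lambda>i. B i \<union> B' i)"
proof (cases "\<mu> = 0")
  case False
  have image: "\<phi> ` B i = \<phi> ` B 0" "\<phi> ` B' i = \<phi> ` B' 0" if "\<phi> \<in> views" "i < \<mu>" for \<phi> i
    using base_row_image[OF B that, of 0] base_row_image[OF B' that, of 0] False by simp_all
  have apart: "\<phi> b \<noteq> \<phi> b'" if "\<phi> \<in> views" "i < \<mu>" "j < \<mu>" "b \<in> B i" "b' \<in> B' j" for \<phi> i j b b'
    using image(1)[OF that(1,2)] image(2)[OF that(1,3)] that(4,5) disj[OF that(1)] by blast
  have fst: "fst \<in> views" by (simp add: views_def)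
  show ?thesis
    unfolding base_row_def
  proof (intro conjI ballI allI impI)
    fix i assume i: "i < \<mu>"
    have "B i \<inter> B' i = {}" using apart[OF fst i i] by blast
    then show "card (B i \<union> B' i) = k + k'"
      using base_row_card[OF B i] base_row_card[OF B' i] by (simp add: card_Un_disjoint)
    show "finite (B i \<union> B' i)"
      using base_row_card[OF B i] base_row_card[OF B' i] by simp
  next
    fix \<phi> i assume \<phi>: "\<phi> \<in> views" and i: "i < \<mu>"
    show "inj_on (\<lambda>b. \<phi> b mod 0) (B i \<union> B' i)"
      unfolding inj_on_Un using base_row_inj[OF B \<phi> i] base_row_inj[OF B' \<phi> i] apart[OF \<phi> i i] by auto
  next
    fix \<phi> i j assume \<phi>: "\<phi> \<in> views" and ij: "i < \<mu>" "j < \<mu>"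
    show "(\<lambda>b. \<phi> b mod 0) ` (B i \<union> B' i) = (\<lambda>b. \<phi> b mod 0) ` (B j \<union> B' j)"
      unfolding image_Un base_row_image[OF B \<phi> ij] base_row_image[OF B' \<phi> ij] ..
  next
    fix i j b b' assume ij: "i < \<mu>" "j < \<mu>" and b: "b \<in> B i \<union> B' i" "b' \<in> B j \<union> B' j"
      and eq: "fst b mod 0 = fst b' mod 0" "snd b mod 0 = snd b' mod 0"
    have "(b \<in> B i \<and> b' \<in> B j) \<or> (b \<in> B' i \<and> b' \<in> B' j)"
      using apart[OF fst ij(1) ij(2), of b b'] apart[OF fst ij(2) ij(1), of b' b] b eq by auto
    then show "i = j" using base_row_disjoint[OF B ij _ _ eq] base_row_disjoint[OF B' ij _ _ eq] by blast
  qed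
qed (simp add: base_row_def)

lemma stackable_if_integer_row:
  assumes "integer_row \<mu> k w B"
  shows "stackable \<mu> k w"
proof -
  have B: "base_row \<mu> k 0 B" and v: "\<And>\<phi>. \<phi> \<in> views \<Longrightarrow> \<exists>l. \<phi> ` B 0 \<subseteq> {l..<l + int w}"
    using assms unfolding integer_row_def by blast+
  obtain c d where c: "fst ` B 0 \<subseteq> {c..<c + int w}"
    and d: "(\<lambda>b. snd b - fst b) ` B 0 \<subseteq> {d..<d + int w}"
    using v[of fst] v[of "\<lambda>b. snd b - fst b"] by (auto simp: views_def)
  show ?thesis
    unfolding stackable_def
    by (rule exI, rule conjI, rule base_row_translate[OF B, of "- c" "- c - d"])
      (use c d in \<open>fastforce simp: image_image\<close>)
qed

text \<open>The second row is translated by \<open>w\<close> in the domain and by \<open>2 * w\<close> in the image, so its difference set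
  moves by \<open>w\<close> and all three views of the two rows are disjoint.\<close>

lemma stackable_add:
  assumes "stackable \<mu> k w" "stackable \<mu> k' w'"
  shows "stackable \<mu> (k + k') (w + w')"
proof -
  obtain B where B: "base_row \<mu> k 0 B" "fst ` B 0 \<subseteq> {0..<int w}"
    "(\<lambda>b. snd b - fst b) ` B 0 \<subseteq> {0..<int w}"
    using assms(1) unfolding stackable_def by blast
  obtain B' where B': "base_row \<mu> k' 0 B'" "fst ` B' 0 \<subseteq> {0..<int w'}"
    "(\<lambda>b. snd b - fst b) ` B' 0 \<subseteq> {0..<int w'}"
    using assms(2) unfolding stackable_def by blast
  let ?C = "\<lambda>i. (\<lambda>b. (fst b + int w, snd b + 2 * int w)) ` B' i"
  have b: "0 \<le> fst b \<and> fst b < int w \<and> 0 \<le> snd b - fst b \<and> snd b - fst b < int w" if "b \<in> B 0" for b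
    using B(2,3) that by force
  have b': "0 \<le> fst b \<and> fst b < int w' \<and> 0 \<le> snd b - fst b \<and> snd b - fst b < int w'" if "b \<in> B' 0" for b
    using B'(2,3) that by force
  have "base_row \<mu> (k + k') 0 (\<lambda>i. B i \<union> ?C i)"
  proof (rule base_row_Un[OF B(1) base_row_translate[OF B'(1)]])
    fix \<phi> assume "\<phi> \<in> views"
    moreover have "\<phi> x \<noteq> \<phi> y" if x: "x \<in> B 0" and y: "y \<in> ?C 0" and \<phi>: "\<phi> \<in> views" for x y \<phi>
    proof -
      obtain z where z: "z \<in> B' 0" "y = (fst z + int w, snd z + 2 * int w)" using y by blast
      show ?thesis using b[OF x] b'[OF z(1)] \<phi> unfolding views_def z(2) by auto
    qed
    ultimately show "\<phi> ` B 0 \<inter> \<phi> ` ?C 0 = {}" by blast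
  qed
  moreover have "fst ` (B 0 \<union> ?C 0) \<subseteq> {0..<int (w + w')}"
    using b b' by force
  moreover have "(\<lambda>b. snd b - fst b) ` (B 0 \<union> ?C 0) \<subseteq> {0..<int (w + w')}"
    using b b' by force
  ultimately show ?thesis unfolding stackable_def by blast
qed

lemma has_trade_stackable:
  assumes "stackable \<mu> k w" "2 * w \<le> m" "0 < m"
  shows "has_trade \<mu> k m"
proof -
  obtain B where B: "base_row \<mu> k 0 B" "fst ` B 0 \<subseteq> {0..<int w}"
    "(\<lambda>b. snd b - fst b) ` B 0 \<subseteq> {0..<int w}"
    using assms(1) unfolding stackable_def by blast
  have "\<phi> ` B 0 \<subseteq> {0..<0 + int (2 * w)}" if "\<phi> \<in> views" for \<phi>
    using B(2,3) that unfolding views_def by force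
  then have "integer_row \<mu> k (2 * w) B" using B(1) unfolding integer_row_def by blast
  then show ?thesis by (rule has_trade_integer_row) (use assms in simp_all)
qed

section \<open>Explicit base rows\<close>

text \<open>An executable form of \<open>base_row\<close>, in which the pairs of each bijection are listed.\<close>

definition list_row :: "nat \<Rightarrow> int \<Rightarrow> (int \<times> int) list list \<Rightarrow> bool" where
  "list_row k m bs \<longleftrightarrow>
     (\<forall>xs\<in>set bs. length xs = k \<and>
        distinct (map (\<lambda>b. fst b mod m) xs) \<and> distinct (map (\<lambda>b. snd b mod m) xs) \<and>
        distinct (map (\<lambda>b. (snd b - fst b) mod m) xs)) \<and>
     (\<forall>xs\<in>set bs. \<forall>ys\<in>set bs.
        set (map (\<lambda>b. fst b mod m) xs) = set (map (\<lambda>b. fst b mod m) ys) \<and>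
        set (map (\<lambda>b. snd b mod m) xs) = set (map (\<lambda>b. snd b mod m) ys) \<and>
        set (map (\<lambda>b. (snd b - fst b) mod m) xs) = set (map (\<lambda>b. (snd b - fst b) mod m) ys)) \<and>
     sorted_wrt (\<lambda>xs ys. \<forall>b\<in>set xs. \<forall>b'\<in>set ys.
        (fst b mod m, snd b mod m) \<noteq> (fst b' mod m, snd b' mod m)) bs"

lemma base_row_if_list_row:
  assumes L: "list_row k m bs"
  shows "base_row (length bs) k m (\<lambda>i. set (bs ! i))"
proof -
  have mem: "bs ! i \<in> set bs" if "i < length bs" for i using that by simp
  have d: "length xs = k" "distinct (map (\<lambda>b. \<phi> b mod m) xs)" if "xs \<in> set bs" "\<phi> \<in> views" for xs \<phi>
    using L that unfolding list_row_def views_def by auto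
  have im: "set (map (\<lambda>b. \<phi> b mod m) xs) = set (map (\<lambda>b. \<phi> b mod m) ys)"
    if "xs \<in> set bs" "ys \<in> set bs" "\<phi> \<in> views" for xs ys \<phi>
  proof -
    have "set (map (\<lambda>b. fst b mod m) xs) = set (map (\<lambda>b. fst b mod m) ys) \<and>
        set (map (\<lambda>b. snd b mod m) xs) = set (map (\<lambda>b. snd b mod m) ys) \<and>
        set (map (\<lambda>b. (snd b - fst b) mod m) xs) = set (map (\<lambda>b. (snd b - fst b) mod m) ys)"
      using L that(1,2) unfolding list_row_def by blast
    then show ?thesis using that(3) unfolding views_def by blast
  qed
  have apart: "(fst b mod m, snd b mod m) \<noteq> (fst b' mod m, snd b' mod m)"
    if "i < j" "j < length bs" "b \<in> set (bs ! i)" "b' \<in> set (bs ! j)" for i j b b'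
    using L that unfolding list_row_def sorted_wrt_iff_nth_less by blast
  show ?thesis
    unfolding base_row_def
  proof (intro conjI ballI allI impI)
    fix i assume i: "i < length bs"
    have "distinct (bs ! i)" "length (bs ! i) = k"
      using d[OF mem[OF i], of fst] by (auto simp: views_def distinct_map)
    then show "card (set (bs ! i)) = k" by (simp add: distinct_card)
  next
    fix \<phi> i assume "\<phi> \<in> views" "i < length bs"
    then show "inj_on (\<lambda>b. \<phi> b mod m) (set (bs ! i))" using d(2) mem by (simp add: distinct_map)
  next
    fix \<phi> i j assume \<phi>: "\<phi> \<in> views" and ij: "i < length bs" "j < length bs"
    show "(\<lambda>b. \<phi> b mod m) ` set (bs ! i) = (\<lambda>b. \<phi> b mod m) ` set (bs ! j)"
      using im[OF mem[OF ij(1)] mem[OF ij(2)] \<phi>] by simp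
  next
    fix i j b b' assume "i < length bs" "j < length bs" "b \<in> set (bs ! i)" "b' \<in> set (bs ! j)"
      and "fst b mod m = fst b' mod m" "snd b mod m = snd b' mod m"
    then show "i = j" using apart[of i j b b'] apart[of j i b' b] by (metis linorder_neqE_nat)
  qed simp
qed

definition narrow_list_row :: "nat \<Rightarrow> int \<Rightarrow> (int \<times> int) list list \<Rightarrow> bool" where
  "narrow_list_row k w bs \<longleftrightarrow> list_row k 0 bs \<and>
     (\<forall>b\<in>set (hd bs). \<forall>b'\<in>set (hd bs).
        fst b - fst b' < w \<and> snd b - snd b' < w \<and> (snd b - fst b) - (snd b' - fst b') < w)"

lemma integer_row_if_narrow_list_row:
  assumes "narrow_list_row k (int w) bs" and "bs \<noteq> []"
  shows "integer_row (length bs) k w (\<lambda>i. set (bs ! i))"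
  unfolding integer_row_def
proof (intro conjI ballI)
  show "base_row (length bs) k 0 (\<lambda>i. set (bs ! i))"
    using assms base_row_if_list_row unfolding narrow_list_row_def by blast
  fix \<phi> assume \<phi>: "\<phi> \<in> views"
  let ?X = "\<phi> ` set (bs ! 0)"
  have "\<phi> b - \<phi> b' < int w" if "b \<in> set (bs ! 0)" "b' \<in> set (bs ! 0)" for b b'
    using assms that \<phi> unfolding narrow_list_row_def views_def by (auto simp: hd_conv_nth)
  then have lt: "x - y < int w" if "x \<in> ?X" "y \<in> ?X" for x y using that by blast
  show "\<exists>l. ?X \<subseteq> {l..<l + int w}"
  proof (cases "?X = {}")
    case False
    have "x \<in> {Min ?X..<Min ?X + int w}" if "x \<in> ?X" for x
      using lt[OF that, of "Min ?X"] False that by simp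
    then show ?thesis by blast
  qed simp
qed

lemma ex_integer_rowI:
  assumes "narrow_list_row k (int w) bs" "length bs = \<mu>" "0 < \<mu>"
  shows "\<exists>B. integer_row \<mu> k w B"
  using integer_row_if_narrow_list_row[OF assms(1)] assms(2,3) by auto

lemma has_trade_list_row:
  assumes "list_row k (int m) bs" "length bs = \<mu>" "0 < m"
  shows "has_trade \<mu> k m"
  using has_trade_develop[OF base_row_if_list_row[OF assms(1)]] assms(2,3) by simp

text \<open>For odd \<open>k\<close> the domain, the image and the difference
  set are intervals of length \<open>k\<close>. For even \<open>k\<close> they cannot all be intervals, since the sum of the
  differences is the difference of the sums of image and domain; for \<open>k = 8, 10, 12\<close> the difference
  set is \<open>{- k div 2..k div 2}\<close> without 0, and for \<open>k = 6\<close> the spread is 8.\<close>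

lemma integer_row_6: "\<exists>B. integer_row 3 6 8 B"
proof (rule ex_integer_rowI)
  show "narrow_list_row 6 (int 8) (map (zip [0..5])
     [[0, 5, 1, 4, 6, 2],
      [4, 0, 2, 5, 1, 6],
      [2, 1, 6, 0, 5, 4]])"
    by code_simp
qed simp_all

lemma integer_row_7: "\<exists>B. integer_row 3 7 7 B"
proof (rule ex_integer_rowI)
  show "narrow_list_row 7 (int 7) (map (zip [0..6])
     [[3, 2, 0, 5, 1, 4, 6],
      [0, 3, 1, 6, 5, 2, 4],
      [2, 0, 5, 1, 4, 6, 3]])"
    by code_simp
qed simp_all

lemma integer_row_8: "\<exists>B. integer_row 3 8 9 B"
proof (rule ex_integer_rowI)
  show "narrow_list_row 8 (int 9) (map (zip [0..7])
     [[4, 3, 1, 0, 7, 6, 2, 5],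
      [1, 4, 0, 7, 6, 2, 5, 3],
      [3, 0, 6, 5, 2, 1, 7, 4]])"
    by code_simp
qed simp_all

lemma integer_row_9: "\<exists>B. integer_row 3 9 9 B"
proof (rule ex_integer_rowI)
  show "narrow_list_row 9 (int 9) (map (zip [0..8])
     [[2, 0, 3, 7, 1, 8, 6, 5, 4],
      [3, 5, 1, 4, 0, 2, 8, 7, 6],
      [1, 3, 0, 6, 8, 5, 2, 4, 7]])"
    by code_simp
qed simp_all

lemma integer_row_10: "\<exists>B. integer_row 3 10 11 B"
proof (rule ex_integer_rowI)
  show "narrow_list_row 10 (int 11) (map (zip [0..9])
     [[3, 0, 4, 7, 9, 2, 1, 8, 6, 5],
      [4, 2, 1, 8, 0, 7, 9, 5, 3, 6],
      [2, 5, 7, 6, 1, 0, 4, 3, 9, 8]])"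
    by code_simp
qed simp_all

lemma integer_row_11: "\<exists>B. integer_row 3 11 11 B"
proof (rule ex_integer_rowI)
  show "narrow_list_row 11 (int 11) (map (zip [0..10])
     [[2, 0, 6, 8, 5, 3, 1, 10, 4, 9, 7],
      [3, 2, 1, 7, 9, 0, 8, 4, 6, 5, 10],
      [0, 5, 7, 2, 1, 6, 9, 3, 10, 4, 8]])"
    by code_simp
qed simp_all

lemma integer_row_12: "\<exists>B. integer_row 3 12 13 B"
proof (rule ex_integer_rowI)
  show "narrow_list_row 12 (int 13) (map (zip [0..11])
     [[3, 0, 7, 9, 6, 2, 1, 11, 4, 10, 8, 5],
      [4, 3, 1, 8, 10, 6, 0, 2, 11, 5, 7, 9],
      [2, 5, 8, 4, 1, 0, 11, 10, 6, 3, 9, 7]])"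
    by code_simp
qed simp_all

lemma integer_row_13: "\<exists>B. integer_row 3 13 13 B"
proof (rule ex_integer_rowI)
  show "narrow_list_row 13 (int 13) (map (zip [0..12])
     [[3, 1, 8, 5, 9, 4, 0, 2, 12, 6, 11, 7, 10],
      [5, 0, 4, 7, 10, 2, 1, 8, 11, 3, 6, 9, 12],
      [4, 3, 0, 6, 1, 11, 2, 12, 8, 10, 9, 5, 7]])"
    by code_simp
qed simp_all

lemma integer_row_15: "\<exists>B. integer_row 3 15 15 B"
proof (rule ex_integer_rowI)
  show "narrow_list_row 15 (int 15) (map (zip [0..14])
     [[3, 2, 7, 9, 8, 1, 0, 14, 10, 6, 5, 4, 12, 11, 13],
      [5, 8, 1, 0, 4, 3, 12, 11, 2, 10, 13, 6, 14, 9, 7],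
      [2, 7, 3, 10, 1, 4, 11, 0, 12, 5, 8, 14, 6, 13, 9]])"
    by code_simp
qed simp_all

text \<open>In the rows for the remaining small orders, the three difference sets agree modulo \<open>m\<close> but not as
  sets of integers.\<close>

lemma has_trade_4_5: "has_trade 3 4 5"
proof (rule has_trade_list_row)
  show "list_row 4 (int 5) (map (zip [0, 1, 2, 3])
     [[1, 3, 0, 2], [3, 2, 1, 0], [2, 0, 3, 1]])"
    by code_simp
qed simp_all

lemma has_trade_5_7: "has_trade 3 5 7"
proof (rule has_trade_list_row)
  show "list_row 5 (int 7) (map (zip [0, 1, 2, 3, 4])
     [[2, 4, 0, 3, 1], [4, 3, 2, 1, 0], [3, 1, 4, 0, 2]])"
    by code_simp
qed simp_all

lemma has_trade_5_8: "has_trade 3 5 8"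
proof (rule has_trade_list_row)
  show "list_row 5 (int 8) (map (zip [0, 1, 2, 3, 4])
     [[2, 5, 1, 0, 4], [5, 1, 4, 2, 0], [4, 0, 2, 5, 1]])"
    by code_simp
qed simp_all

lemma has_trade_5_9: "has_trade 3 5 9"
proof (rule has_trade_list_row)
  show "list_row 5 (int 9) (map (zip [0, 1, 2, 3, 6])
     [[1, 0, 2, 6, 3], [6, 1, 3, 2, 0], [3, 2, 1, 0, 6]])"
    by code_simp
qed simp_all

lemma has_trade_5_11: "has_trade 3 5 11"
proof (rule has_trade_list_row)
  show "list_row 5 (int 11) (map (zip [0, 1, 2, 4, 7])
     [[0, 6, 1, 2, 9], [9, 0, 2, 6, 1], [2, 1, 0, 9, 6]])"
    by code_simp
qed simp_all

lemma has_trade_6_7: "has_trade 3 6 7"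
proof (rule has_trade_list_row)
  show "list_row 6 (int 7) (map (zip [0, 1, 2, 3, 4, 5])
     [[1, 3, 5, 0, 2, 4], [3, 0, 4, 1, 5, 2], [2, 5, 0, 4, 3, 1]])"
    by code_simp
qed simp_all

section \<open>Small degrees and large orders\<close>

text \<open>From 4 on, 6, 7 and 11 are the only numbers that are not sums of fours and fives.\<close>

lemma has_trade_4:
  assumes "4 \<le> m" "m \<notin> {6, 7, 11}"
  shows "has_trade 3 4 m"
  using assms
proof (induction m rule: less_induct)
  case (less m)
  have 4: "has_trade 3 4 4" by (rule has_trade_full) simp
  \<comment> \<open>subtracting 4 from 10 or 15 would reach an excluded order\<close>
  consider "m = 4" | "m = 5" | "m = 10" | "m = 15" | "4 \<le> m - 4" "m - 4 \<notin> {6, 7, 11}" "m = m - 4 + 4"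
    using less.prems by force
  then show ?case
  proof cases
    case 3
    then show ?thesis using has_trade_add[OF has_trade_4_5 has_trade_4_5] by simp
  next
    case 4
    then show ?thesis
      using has_trade_add[OF has_trade_4_5 has_trade_add[OF has_trade_4_5 has_trade_4_5]] by simp
  next
    case 5
    have "has_trade 3 4 (m - 4)" by (rule less.IH) (use 5 in auto)
    then show ?thesis using has_trade_add[OF _ 4] 5(3) by metis
  qed (use 4 has_trade_4_5 in simp_all)
qed

lemma has_trade_5:
  assumes "5 \<le> m" "m \<noteq> 6"
  shows "has_trade 3 5 m"
  using assms
proof (induction m rule: less_induct)
  case (less m)
  have 5: "has_trade 3 5 5" by (rule has_trade_full) simp
  consider "m \<in> {5, 7, 8, 9, 11}" | "5 \<le> m - 5" "m - 5 \<noteq> 6" "m = m - 5 + 5"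
    using less.prems by force
  then show ?case
  proof cases
    case 2
    have "has_trade 3 5 (m - 5)" by (rule less.IH) (use 2 in auto)
    then show ?thesis using has_trade_add[OF _ 5] 2(3) by metis
  qed (use 5 has_trade_5_7 has_trade_5_8 has_trade_5_9 has_trade_5_11 in auto)
qed

lemma has_trade_6:
  assumes "6 \<le> m" shows "has_trade 3 6 m"
proof -
  consider "m = 6" | "m = 7" | "8 \<le> m" using assms by linarith
  then show ?thesis
  proof cases
    case 1
    then show ?thesis using has_trade_full[of 3 6] by simp
  next
    case 2
    then show ?thesis using has_trade_6_7 by simp
  next
    case 3
    then show ?thesis using integer_row_6 has_trade_integer_row by auto
  qed
qed

lemma has_trade_medium:
  assumes k: "k \<in> {7..13} \<union> {15}" and m: "k \<le> m"
  shows "has_trade 3 k m"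
proof (cases "m = k")
  case True
  then show ?thesis using has_trade_full[of 3 k] k by auto
next
  case False
  have "k \<in> {7, 8, 9, 10, 11, 12, 13, 15}" using k by auto
  then have "\<exists>B w. integer_row 3 k w B \<and> w \<le> k + 1"
    using integer_row_7 integer_row_8 integer_row_9 integer_row_10 integer_row_11 integer_row_12
      integer_row_13 integer_row_15 by fastforce
  then show ?thesis using has_trade_integer_row[of 3 k] m False k by fastforce
qed

lemma has_trade_small:
  assumes "4 \<le> k" "k \<le> 13" "k \<le> m" "(k, m) \<notin> {(4, 6), (4, 7), (4, 11), (5, 6)}"
  shows "has_trade 3 k m"
proof -
  consider "k = 4" | "k = 5" | "k = 6" | "k \<in> {7..13} \<union> {15}" using assms(1,2) by force
  then show ?thesis
    by cases (use assms has_trade_4 has_trade_5 has_trade_6 has_trade_medium in auto)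
qed

text \<open>The rows of sizes 6 to 11 start an induction that adds the row of size 6.\<close>

lemma stackable_ge_6:
  assumes "6 \<le> k" shows "stackable 3 k (2 * k)"
  using assms
proof (induction k rule: less_induct)
  case (less k)
  have wide: "stackable 3 k (2 * k)" if s: "stackable 3 k w" and w: "w \<le> 2 * k" for k w
  proof -
    obtain B where "base_row 3 k 0 B" "fst ` B 0 \<subseteq> {0..<int w}"
        "(\<lambda>b. snd b - fst b) ` B 0 \<subseteq> {0..<int w}"
      using s unfolding stackable_def by blast
    moreover have "{0..<int w} \<subseteq> {0..<int (2 * k)}" using w by simp
    ultimately show ?thesis unfolding stackable_def by blast
  qed
  have 6: "stackable 3 6 (2 * 6)"
    using wide[OF stackable_if_integer_row] integer_row_6 by fastforce
  show ?case
  proof (cases "k < 12")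
    case True
    then have "k \<in> {6, 7, 8, 9, 10, 11}" using less.prems by auto
    then show ?thesis
      using 6 wide[OF stackable_if_integer_row] integer_row_7 integer_row_8 integer_row_9
        integer_row_10 integer_row_11 by fastforce
  next
    case False
    have "stackable 3 (k - 6) (2 * (k - 6))" by (rule less.IH) (use False in auto)
    from stackable_add[OF this 6] show ?thesis using False by (simp add: algebra_simps)
  qed
qed

lemma has_trade_large:
  assumes "6 \<le> k" "4 * k \<le> m" shows "has_trade 3 k m"
  by (rule has_trade_stackable[OF stackable_ge_6]) (use assms in auto)

section \<open>Multiples of 5 and of 7\<close>

text \<open>The summands will be the degrees of the trades in a blow-up. They are chosen greedily, each as
  large as the rest permits.\<close>

lemma ex_bounded_summands:
  fixes a n k p :: nat
  assumes "a * p \<le> k" "k \<le> n * p"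
  shows "\<exists>d. (\<forall>t<p. a \<le> d t \<and> d t \<le> n) \<and> (\<Sum>t<p. d t) = k"
  using assms
proof (induction p arbitrary: k)
  case (Suc p)
  define x where "x = min n (k - a * p)"
  have an: "a \<le> n" using Suc.prems by (metis Suc_mult_le_cancel1 le_trans mult.commute)
  have x: "a \<le> x" "x \<le> n" "a * p \<le> k - x" "k - x \<le> n * p" "x \<le> k"
    using Suc.prems an unfolding x_def by (auto simp: min_def)
  obtain d where d: "\<forall>t<p. a \<le> d t \<and> d t \<le> n" "(\<Sum>t<p. d t) = k - x" using Suc.IH[OF x(3,4)] by blast
  have "(\<Sum>t<Suc p. (d(p := x)) t) = k" using d(2) x(5) by simp
  moreover have "\<forall>t<Suc p. a \<le> (d(p := x)) t \<and> (d(p := x)) t \<le> n" using d(1) x(1,2) by (simp add: less_Suc_eq)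
  ultimately show ?case by blast
qed simp

text \<open>The values of \<open>t\<close> beyond the \<open>p\<close> summands receive the empty trade.\<close>

lemma has_trade_of_summands:
  assumes l: "odd l \<or> l = 4" and n: "\<And>j. a \<le> j \<Longrightarrow> j \<le> n \<Longrightarrow> has_trade \<mu> j n"
    and p: "p \<le> l" "a * p \<le> k" "k \<le> n * p"
  shows "has_trade \<mu> k (l * n)"
proof -
  obtain q w where qw: "orthogonal_squares l q w"
    using l orthogonal_squares_odd orthogonal_squares_4 by metis
  obtain d where d: "\<And>t. t < p \<Longrightarrow> a \<le> d t \<and> d t \<le> n" "(\<Sum>t<p. d t) = k"
    using ex_bounded_summands[OF p(2,3)] by blast
  let ?d = "\<lambda>t. if t < p then d t else 0"
  have "has_trade \<mu> (\<Sum>t<l. ?d t) (l * n)"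
    by (rule has_trade_blowup[OF qw]) (use d n has_trade_empty in auto)
  moreover have "(\<Sum>t<l. ?d t) = k"
  proof -
    have "{..<l} \<inter> {t. t < p} = {..<p}" using p(1) by auto
    then show ?thesis using d(2) by (simp add: sum.If_cases)
  qed
  ultimately show ?thesis by simp
qed

text \<open>With \<open>p\<close> the least number such that \<open>k \<le> n * p\<close>, the summands can be chosen in \<open>{a..n}\<close> provided
  \<open>a * p \<le> k\<close>. This follows from \<open>n * (p - 1) < k\<close> except when \<open>p\<close> is small, where \<open>14 \<le> k\<close>
  enters.\<close>

lemma has_trade_multiple:
  assumes l: "odd l \<or> l = 4" and n: "\<And>j. a \<le> j \<Longrightarrow> j \<le> n \<Longrightarrow> has_trade \<mu> j n"
    and k: "14 \<le> k" "k \<le> l * n" and a: "n = 5 \<and> a = 4 \<or> n = 7 \<and> a = 5 \<or> 10 \<le> n \<and> a = 4"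
  shows "has_trade \<mu> k (l * n)"
proof -
  define p where "p = (k + n - 1) div n"
  have n0: "0 < n" using a by auto
  have le: "k \<le> n * p" "n * p < k + n"
  proof -
    have "n * p + (k + n - 1) mod n = k + n - 1" unfolding p_def by simp
    moreover have "(k + n - 1) mod n < n" using n0 by simp
    ultimately show "k \<le> n * p" "n * p < k + n" using n0 k(1) by linarith+
  qed
  have pl: "p \<le> l"
  proof (rule ccontr)
    assume "\<not> p \<le> l"
    then have "n * Suc l \<le> n * p" by (intro mult_le_mono2) simp
    then show False using le(2) k(2) by (simp add: mult.commute)
  qed
  have "a * p \<le> k"
  proof -
    consider "n = 5" "a = 4" | "n = 7" "a = 5" | "10 \<le> n" "a = 4" using a by blast
    then show ?thesis
    proof cases
      case 3
      show ?thesis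
      proof (cases "p \<le> 1")
        case True
        then show ?thesis using 3 k(1) by simp
      next
        case False
        then have "n * p = n * (p - 1) + n" by (simp add: algebra_simps)
        then have "n * (p - 1) < k" using le(2) by simp
        moreover have "10 * (p - 1) \<le> n * (p - 1)" using 3 by (intro mult_le_mono1)
        ultimately show ?thesis unfolding 3(2) using False by linarith
      qed
    next
      case 1
      then show ?thesis using le k(1) by simp
    next
      case 2
      then show ?thesis using le k(1) by simp
    qed
  qed
  from has_trade_of_summands[OF l n pl this le(1)] show ?thesis .
qed

text \<open>Here \<open>a\<close> is the least positive degree from which on all trades of order \<open>n\<close> exist. Write \<open>m = x * n\<close>.
  If \<open>x\<close> is odd or 4, trades of order \<open>n\<close> are blown up. If \<open>x\<close> is a larger multiple of 4, those of order
  \<open>m div 4\<close> are, which exist by induction. If \<open>x\<close> is twice an odd number, those of order \<open>2 * n\<close>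
  are; for \<open>x = 2\<close> itself the only degree not below 14 is \<open>k = m = 14\<close>.\<close>

lemma has_trade_multiple_of_5_or_7:
  fixes n a :: nat
  assumes na: "(n, a) \<in> {(5, 4), (7, 5)}" and "14 \<le> k" "k \<le> x * n"
  shows "has_trade 3 k (x * n)"
  using assms(2,3)
proof (induction x arbitrary: k rule: less_induct)
  case (less x)
  have base: "has_trade 3 j n" if "a \<le> j" "j \<le> n" for j
    by (rule has_trade_small) (use na that in auto)
  have all: "has_trade 3 j (y * n)" if "2 \<le> y" "y < x" "4 \<le> j" "j \<le> y * n" for y j
  proof (cases "14 \<le> j")
    case True
    then show ?thesis using less.IH that by blast
  next
    case False
    have "10 \<le> y * n" using that(1) na mult_le_mono[of 2 y 5 n] by auto
    moreover have "y * n \<noteq> 11" 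
      using na by auto presburger+
    ultimately show ?thesis using that False by (intro has_trade_small) auto
  qed
  have step: "has_trade 3 k (l * (y * n))" if "x = l * y" "odd l \<or> l = 4" "2 \<le> y" "y < x" for l y
  proof (rule has_trade_multiple[OF that(2), where a = 4])
    show "has_trade 3 j (y * n)" if "4 \<le> j" "j \<le> y * n" for j
      using all that \<open>2 \<le> y\<close> \<open>y < x\<close> by blast
    have "2 * 5 \<le> y * n" using \<open>2 \<le> y\<close> na by (intro mult_le_mono) auto
    then show "y * n = 5 \<and> 4 = (4 :: nat) \<or> y * n = 7 \<and> 4 = (5 :: nat) \<or> 10 \<le> y * n \<and> 4 = (4 :: nat)" by simp
  qed (use less.prems that in \<open>simp_all add: mult.assoc\<close>)
  consider "odd x \<or> x = 4" | "x = 2" | y where "x = 4 * y" "2 \<le> y" | l where "odd l" "x = l * 2" "3 \<le> l"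
  proof -
    assume *: "odd x \<or> x = 4 \<Longrightarrow> thesis" "x = 2 \<Longrightarrow> thesis"
      "\<And>y. x = 4 * y \<Longrightarrow> 2 \<le> y \<Longrightarrow> thesis" "\<And>l. odd l \<Longrightarrow> x = l * 2 \<Longrightarrow> 3 \<le> l \<Longrightarrow> thesis"
    have "x \<noteq> 0" using less.prems by (cases x) auto
    show thesis
    proof (cases "odd x \<or> x = 4 \<or> x = 2")
      case False
      then obtain z where z: "x = 2 * z" by blast
      show thesis
      proof (cases "even z")
        case True
        then obtain y where "z = 2 * y" by blast
        then show thesis using *(3)[of y] z False \<open>x \<noteq> 0\<close> by force
      next
        case odd: False
        then have "z \<noteq> 1" "z \<noteq> 0" using z False \<open>x \<noteq> 0\<close> by auto
        moreover have "z \<noteq> 2" using odd by auto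
        ultimately show thesis using *(4)[of z] z odd by simp
      qed
    qed (use * in blast)
  qed
  then show ?case
  proof cases
    case 1
    show ?thesis by (rule has_trade_multiple[OF 1 base]) (use less.prems na in auto)
  next
    case 2
    have "x * n \<in> {10, 14}" using 2 na by auto
    then have "k = x * n" using less.prems by auto
    then show ?thesis using has_trade_full[of 3 "x * n"] less.prems by simp
  next
    case (3 y)
    then show ?thesis using step[of 4 y] by (simp add: mult.assoc)
  next
    case (4 l)
    then show ?thesis using step[of l 2] by (simp add: mult.assoc)
  qed
qed

section \<open>No trades of degree 4 and order 6 or 7\<close>

text \<open>The shape of the complements of the symbol sets of the columns of a \<open>(3, 4, d + 4)\<close> trade: \<open>Y c\<close>
  consists of the symbols that do not occur in column \<open>c\<close>.\<close>

definition block_family :: "nat \<Rightarrow> 's set \<Rightarrow> 'c set \<Rightarrow> ('c \<Rightarrow> 's set) \<Rightarrow> bool" where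
  "block_family d S J Y \<longleftrightarrow>
     finite S \<and> card S = d + 4 \<and> finite J \<and> card J = d + 4 \<and>
     (\<forall>c\<in>J. Y c \<subseteq> S \<and> card (Y c) = d) \<and> (\<forall>s\<in>S. card {c \<in> J. s \<in> Y c} = d)"

text \<open>The condition imposed on the set \<open>X\<close> of symbols that do not occur in a given row, whose filled
  cells lie in the columns \<open>F\<close>: see \<open>concentrated_if_trade\<close>.\<close>

definition concentrated :: "nat \<Rightarrow> 'c set \<Rightarrow> ('c \<Rightarrow> 's set) \<Rightarrow> 's set \<Rightarrow> bool" where
  "concentrated d J Y X \<longleftrightarrow> (\<exists>F\<subseteq>J. card F = 4 \<and>
     (\<forall>c\<in>F. d - 1 \<le> card (Y c \<inter> X)) \<and> (\<forall>c\<in>F. \<forall>c'\<in>F. c \<noteq> c' \<longrightarrow> Y c \<inter> Y c' \<subseteq> X))"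

lemma sum_card_Int_block_family:
  assumes Y: "block_family d S J Y" and X: "X \<subseteq> S"
  shows "(\<Sum>c\<in>J. card (Y c \<inter> X)) = d * card X"
proof -
  have fin: "finite S" "finite J" using Y unfolding block_family_def by blast+
  then have finX: "finite X" using X finite_subset by blast
  have "(\<Sum>c\<in>J. card (Y c \<inter> X)) = (\<Sum>c\<in>J. \<Sum>s\<in>X. if s \<in> Y c then 1 else 0)"
    using finX by (intro sum.cong refl) (simp add: sum.If_cases Int_commute)
  also have "\<dots> = (\<Sum>s\<in>X. \<Sum>c\<in>J. if s \<in> Y c then 1 else 0)" by (rule sum.swap)
  also have "\<dots> = (\<Sum>s\<in>X. card {c \<in> J. s \<in> Y c})"
    using fin by (intro sum.cong refl) (simp add: sum.If_cases Int_def)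
  also have "\<dots> = (\<Sum>s\<in>X. d)"
    using Y X unfolding block_family_def by (intro sum.cong) auto
  finally show ?thesis by simp
qed

text \<open>The intersections with \<open>X\<close> have total size \<open>d\<^sup>2\<close>, and the four filled columns account for at least
  \<open>4 * (d - 1)\<close>. The surplus \<open>(d - 2)\<^sup>2 = d - 2\<close> is 0 or 1, so outside a set \<open>C\<close> of at most
  \<open>d - 2\<close> columns the intersections are as small as possible: empty for the columns \<open>E\<close> of empty
  cells, of size \<open>d - 1\<close> for filled ones.\<close>

lemma concentrated_split:
  assumes Y: "block_family d S J Y" and X: "X \<subseteq> S" "card X = d"
    and conc: "concentrated d J Y X" and d: "d \<in> {2, 3}"
  obtains E C where "E \<subseteq> J" "card E = d" "card C \<le> d - 2" "finite C"
    and "\<And>c. c \<in> E - C \<Longrightarrow> Y c \<inter> X = {}"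
    and "\<And>c. c \<in> J - E \<Longrightarrow> d - 1 \<le> card (Y c \<inter> X)"
    and "\<And>c. c \<in> J - E - C \<Longrightarrow> card (Y c \<inter> X) = d - 1"
    and "\<And>c c'. c \<in> J - E \<Longrightarrow> c' \<in> J - E \<Longrightarrow> c \<noteq> c' \<Longrightarrow> Y c \<inter> Y c' \<subseteq> X"
proof -
  obtain F where F: "F \<subseteq> J" "card F = 4" "\<And>c. c \<in> F \<Longrightarrow> d - 1 \<le> card (Y c \<inter> X)"
    and pair: "\<And>c c'. c \<in> F \<Longrightarrow> c' \<in> F \<Longrightarrow> c \<noteq> c' \<Longrightarrow> Y c \<inter> Y c' \<subseteq> X"
    using conc unfolding concentrated_def by blast
  have fin: "finite S" "finite J" "card J = d + 4" using Y unfolding block_family_def by blast+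
  have finX: "finite X" using X(1) fin(1) by (rule finite_subset)
  have finF: "finite F" using F(1) fin(2) by (rule finite_subset)
  \<comment> \<open>the surplus of an intersection over its least possible size\<close>
  define g where "g c = (if c \<in> F then card (Y c \<inter> X) - (d - 1) else card (Y c \<inter> X))" for c
  have "(\<Sum>c\<in>J. card (Y c \<inter> X)) = (\<Sum>c\<in>J. g c + (if c \<in> F then d - 1 else 0))"
    using F(3) by (intro sum.cong) (auto simp: g_def)
  also have "\<dots> = (\<Sum>c\<in>J. g c) + 4 * (d - 1)"
    using F(1,2) fin(2) by (simp add: sum.distrib sum.If_cases Int_absorb1)
  finally have "(\<Sum>c\<in>J. g c) + 4 * (d - 1) = d * d"
    using sum_card_Int_block_family[OF Y X(1)] X(2) by simp
  then have g: "(\<Sum>c\<in>J. g c) = d - 2" using d by auto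
  let ?C = "{c \<in> J. g c \<noteq> 0}"
  have "card ?C = (\<Sum>c\<in>?C. 1)" by simp
  also have "\<dots> \<le> (\<Sum>c\<in>?C. g c)" by (intro sum_mono) auto
  also have "\<dots> \<le> (\<Sum>c\<in>J. g c)" using fin(2) by (intro sum_mono2) auto
  finally have C: "card ?C \<le> d - 2" using g by simp
  show thesis
  proof (rule that)
    show "J - F \<subseteq> J" "card (J - F) = d" using F(1,2) finF fin(3) by (auto simp: card_Diff_subset)
    show "card ?C \<le> d - 2" by (rule C)
    show "finite ?C" using fin(2) by simp
    show "Y c \<inter> X = {}" if "c \<in> J - F - ?C" for c using that finX by (auto simp: g_def)
    show "d - 1 \<le> card (Y c \<inter> X)" if "c \<in> J - (J - F)" for c using that F(3) by blast
    show "card (Y c \<inter> X) = d - 1" if "c \<in> J - (J - F) - ?C" for c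
      using that F(3)[of c] by (auto simp: g_def)
    show "Y c \<inter> Y c' \<subseteq> X" if "c \<in> J - (J - F)" "c' \<in> J - (J - F)" "c \<noteq> c'" for c c'
      using that pair by blast
  qed
qed

lemma ex_disjoint_block:
  assumes "block_family d S J Y" "X \<subseteq> S" "card X = d" "concentrated d J Y X" and d: "d \<in> {2, 3}"
  shows "\<exists>c\<in>J. Y c \<inter> X = {}"
proof -
  obtain E C where E: "E \<subseteq> J" "card E = d" and C: "card C \<le> d - 2" "finite C"
    and zero: "\<And>c. c \<in> E - C \<Longrightarrow> Y c \<inter> X = {}"
    using concentrated_split[OF assms] by metis
  have "\<not> E \<subseteq> C" using card_mono[OF C(2), of E] C(1) E(2) d by auto
  then show ?thesis using E(1) zero by blast
qed

text \<open>A symbol outside \<open>X\<close> is in \<open>d\<close> blocks, at most one of them in a filled column, so it is in all or all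
  but one of the \<open>d\<close> blocks of the columns \<open>E\<close>. If it is not in \<open>Y c1\<close>, it is in every other block of \<open>E\<close>.\<close>

lemma ex_second_disjoint_block:
  assumes Y: "block_family d S J Y" and X: "X \<subseteq> S" "card X = d"
    and conc: "concentrated d J Y X" and d: "d \<in> {2, 3}" and c1: "c1 \<in> J" "Y c1 \<inter> X = {}"
  shows "\<exists>c2\<in>J. c2 \<noteq> c1 \<and> Y c2 \<inter> X = {} \<and> S - X - Y c1 \<subseteq> Y c2"
proof -
  obtain E C where E: "E \<subseteq> J" "card E = d" and C: "card C \<le> d - 2" "finite C"
    and zero: "\<And>c. c \<in> E - C \<Longrightarrow> Y c \<inter> X = {}"
    and big: "\<And>c. c \<in> J - E \<Longrightarrow> d - 1 \<le> card (Y c \<inter> X)"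
    and pair: "\<And>c c'. c \<in> J - E \<Longrightarrow> c' \<in> J - E \<Longrightarrow> c \<noteq> c' \<Longrightarrow> Y c \<inter> Y c' \<subseteq> X"
    using concentrated_split[OF assms(1-5)] by metis
  have finJ: "finite J" using Y unfolding block_family_def by blast
  have finE: "finite E" using E(1) finJ by (rule finite_subset)
  have "c1 \<in> E" using big[of c1] c1 d by auto
  then have card: "card (E - {c1}) = d - 1" using E(2) finE by simp
  have "\<not> E - {c1} \<subseteq> C" using card_mono[OF C(2), of "E - {c1}"] C(1) card d by auto
  then obtain c2 where c2: "c2 \<in> E" "c2 \<noteq> c1" "c2 \<notin> C" by blast
  have "z \<in> Y c2" if z: "z \<in> S - X - Y c1" for z
  proof -
    let ?K = "{c \<in> J. z \<in> Y c}"
    have K: "card ?K = d" using Y z unfolding block_family_def by blast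
    have "c = c'" if "c \<in> ?K - E" "c' \<in> ?K - E" for c c' using that pair[of c c'] z by blast
    then have "card (?K - E) \<le> 1" using finJ by (auto simp: card_le_Suc0_iff_eq)
    moreover have "card ?K = card (?K \<inter> E) + card (?K - E)"
      using finJ by (subst card_Int_Diff[of _ E]) auto
    ultimately have "d - 1 \<le> card (?K \<inter> E)" using K by simp
    moreover have sub: "?K \<inter> E \<subseteq> E - {c1}" using z by blast
    moreover have "card (?K \<inter> E) \<le> card (E - {c1})" using sub finE by (intro card_mono) auto
    ultimately have "?K \<inter> E = E - {c1}"
      using card finE by (intro card_subset_eq) simp_all
    then show ?thesis using c2 by blast
  qed
  then show ?thesis using c2 E(1) zero by blast
qed

text \<open>Start from a row \<open>r\<close>, a column \<open>c1\<close> with \<open>Y c1\<close> disjoint from \<open>X r\<close>, a second such column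
  \<open>c2\<close> for the row \<open>r\<close>, and a second such row \<open>r2\<close> for the column \<open>c1\<close>. The \<open>4 - d\<close> symbols outside
  \<open>X r\<close> and \<open>Y c1\<close> lie in both \<open>Y c2\<close> and \<open>X r2\<close>.

  If \<open>d = 2\<close>, then \<open>Y c2\<close> and \<open>X r2\<close> both equal this set of two symbols, but intersections of size 2
  do not occur. If \<open>d = 3\<close>, there is one such symbol \<open>y\<close>, and \<open>X r2\<close> arises from \<open>X r\<close> by exchanging
  some \<open>e\<close> for \<open>y\<close>. At most one column may meet \<open>X r2\<close> in a single symbol; \<open>c2\<close> does. But among
  the columns that contain \<open>e\<close> at least two meet \<open>X r\<close> in two symbols, at most one of these contains
  \<open>y\<close>, and the other one meets \<open>X r2\<close> in a single symbol too.\<close>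

lemma no_dual_concentrated_families:
  assumes Y: "block_family d S J Y" and X: "block_family d S I X" and d: "d \<in> {2, 3}"
    and rows: "\<And>r. r \<in> I \<Longrightarrow> concentrated d J Y (X r)"
    and cols: "\<And>c. c \<in> J \<Longrightarrow> concentrated d I X (Y c)"
  shows False
proof -
  have S: "finite S" "card S = d + 4" using X unfolding block_family_def by blast+
  have Xr: "X r \<subseteq> S" "card (X r) = d" "finite (X r)" if "r \<in> I" for r
    using X that finite_subset[OF _ S(1)] unfolding block_family_def by auto
  have Yc: "Y c \<subseteq> S" "card (Y c) = d" "finite (Y c)" if "c \<in> J" for c
    using Y that finite_subset[OF _ S(1)] unfolding block_family_def by auto
  have "card I = d + 4" using X unfolding block_family_def by blast
  then obtain r where r: "r \<in> I" by fastforce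
  obtain c1 where c1: "c1 \<in> J" "Y c1 \<inter> X r = {}"
    using ex_disjoint_block[OF Y Xr(1,2)[OF r] rows[OF r] d] by blast
  obtain c2 where c2: "c2 \<in> J" "Y c2 \<inter> X r = {}" "S - X r - Y c1 \<subseteq> Y c2"
    using ex_second_disjoint_block[OF Y Xr(1,2)[OF r] rows[OF r] d c1] by blast
  obtain r2 where r2: "r2 \<in> I" "X r2 \<inter> Y c1 = {}" "S - Y c1 - X r \<subseteq> X r2"
    using ex_second_disjoint_block[OF X Yc(1,2)[OF c1(1)] cols[OF c1(1)] d r] c1(2) by blast
  have rest: "card (S - X r - Y c1) = 4 - d"
  proof -
    have "card (X r \<union> Y c1) = d + d"
      using Xr[OF r] Yc[OF c1(1)] c1(2) by (simp add: card_Un_disjoint Int_commute)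
    moreover have "S - X r - Y c1 = S - (X r \<union> Y c1)" by blast
    ultimately show ?thesis
      using S Xr[OF r] Yc[OF c1(1)] by (simp add: card_Diff_subset)
  qed
  have swap: "S - Y c1 - X r = S - X r - Y c1" by blast
  obtain E C where E: "E \<subseteq> J" "card E = d" and C: "card C \<le> d - 2" "finite C"
    and zero: "\<And>c. c \<in> E - C \<Longrightarrow> Y c \<inter> X r2 = {}"
    and big: "\<And>c. c \<in> J - E \<Longrightarrow> d - 1 \<le> card (Y c \<inter> X r2)"
    and exact: "\<And>c. c \<in> J - E - C \<Longrightarrow> card (Y c \<inter> X r2) = d - 1"
    using concentrated_split[OF Y Xr(1,2)[OF r2(1)] rows[OF r2(1)] d] by metis
  show False
  proof (cases "d = 2")
    case True
    have "C = {}" using C True by simp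
    have "S - X r - Y c1 = Y c2"
      using c2 rest True Yc[OF c2(1)] by (intro card_subset_eq) auto
    moreover have "S - Y c1 - X r = X r2"
    proof (rule card_subset_eq)
      show "card (S - Y c1 - X r) = card (X r2)"
        using rest True Xr[OF r2(1)] unfolding swap by simp
    qed (use r2 Xr[OF r2(1)] in auto)
    ultimately have "Y c2 = X r2" using swap by simp
    then have "card (Y c2 \<inter> X r2) = 2" using Xr[OF r2(1)] True by simp
    then show False
      using zero[of c2] exact[of c2] \<open>C = {}\<close> c2(1) True by (cases "c2 \<in> E") auto
  next
    case False
    then have d3: "d = 3" using d by simp
    obtain y where y: "S - X r - Y c1 = {y}" using rest d3 by (auto simp: card_1_singleton_iff)
    have yX2: "y \<in> X r2" and yY2: "y \<in> Y c2" and yX: "y \<notin> X r" "y \<in> S" using y r2(3) c2(3) by blast+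
    have sub: "X r2 \<subseteq> insert y (X r)" using y r2(2) Xr[OF r2(1)] by blast
    have "\<not> X r \<subseteq> X r2"
      using card_subset_eq[OF Xr(3)[OF r2(1)], of "X r"] Xr[OF r] Xr[OF r2(1)] yX yX2 by auto
    then obtain e where e: "e \<in> X r" "e \<notin> X r2" by blast
    have X2: "X r2 = insert y (X r - {e})"
    proof (rule card_subset_eq)
      show "card (X r2) = card (insert y (X r - {e}))"
        using Xr[OF r] Xr[OF r2(1)] e yX d3 by simp
    qed (use Xr[OF r] sub e in auto)
    have single: "c = c'" if "c \<in> J" "c' \<in> J" "card (Y c \<inter> X r2) = 1" "card (Y c' \<inter> X r2) = 1" for c c'
    proof -
      have "c \<in> C" "c' \<in> C" using that big[of c] big[of c'] zero[of c] zero[of c'] d3 by fastforce+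
      then show ?thesis using C d3 by (auto simp: card_le_Suc0_iff_eq)
    qed
    obtain E' C' where E': "E' \<subseteq> J" "card E' = d" and C': "card C' \<le> d - 2" "finite C'"
      and zero': "\<And>c. c \<in> E' - C' \<Longrightarrow> Y c \<inter> X r = {}"
      and exact': "\<And>c. c \<in> J - E' - C' \<Longrightarrow> card (Y c \<inter> X r) = d - 1"
      and pair': "\<And>c c'. c \<in> J - E' \<Longrightarrow> c' \<in> J - E' \<Longrightarrow> c \<noteq> c' \<Longrightarrow> Y c \<inter> Y c' \<subseteq> X r"
      using concentrated_split[OF Y Xr(1,2)[OF r] rows[OF r] d] by metis
    let ?K = "{c \<in> J. e \<in> Y c} - C'"
    have "card {c \<in> J. e \<in> Y c} = 3" using Y e(1) Xr(1)[OF r] d3 unfolding block_family_def by auto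
    then have K: "2 \<le> card ?K" using diff_card_le_card_Diff[OF C'(2), of "{c \<in> J. e \<in> Y c}"] C' d3 by simp
    have K': "c \<notin> E'" "card (Y c \<inter> X r) = 2" if "c \<in> ?K" for c
      using that zero'[of c] exact'[of c] e(1) d3 by auto
    obtain c where c: "c \<in> ?K" "y \<notin> Y c"
    proof (rule ccontr)
      assume "\<not> thesis"
      then have all: "\<And>c. c \<in> ?K \<Longrightarrow> y \<in> Y c" using that by blast
      have "c = c'" if "c \<in> ?K" "c' \<in> ?K" for c c'
        using pair'[of c c'] K'(1) that all yX by blast
      moreover have "finite ?K" using Y unfolding block_family_def by auto
      ultimately have "card ?K \<le> 1" by (auto simp: card_le_Suc0_iff_eq)
      then show False using K by simp
    qed
    have "Y c \<inter> X r2 = Y c \<inter> X r - {e}" unfolding X2 using c(2) by blast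
    then have "card (Y c \<inter> X r2) = 1" using K'(2)[OF c(1)] c(1) e(1) by simp
    moreover have "Y c2 \<inter> X r2 = {y}" unfolding X2 using c2(2) yY2 by blast
    then have "card (Y c2 \<inter> X r2) = 1" by simp
    ultimately have "c = c2" using single c(1) c2(1) by blast
    then show False using c(2) yY2 by blast
  qed
qed

text \<open>The three symbols of a filled cell belong to its row and to its column, hence the two symbol
  sets share at least three symbols and their complements at least \<open>d - 1\<close>. A symbol \<open>s\<close> of the
  row occupies different cells in the three arrays, so it is missing from at most one of
  the four filled columns.\<close>

lemma concentrated_if_trade:
  assumes T: "trade 3 4 R C S T" and S: "card S = d + 4" and r: "r \<in> R"
  shows "concentrated d C (\<lambda>c. S - {s. \<exists>r. T 0 r c s}) (S - {s. \<exists>c. T 0 r c s})"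
proof -
  have F: "face 3 4 R T" "face 3 4 C (\<lambda>i c s r. T i r c s)" "face 3 4 S (\<lambda>i s r c. T i r c s)"
    using T unfolding trade_def by blast+
  have supp: "\<And>i r c s. i < 3 \<Longrightarrow> T i r c s \<Longrightarrow> r \<in> R \<and> c \<in> C \<and> s \<in> S"
    and disj: "\<And>i j r c s. i < 3 \<Longrightarrow> j < 3 \<Longrightarrow> T i r c s \<Longrightarrow> T j r c s \<Longrightarrow> i = j"
    and finS: "finite S"
    using T unfolding trade_def by blast+
  let ?A = "{s. \<exists>c. T 0 r c s}" and ?B = "\<lambda>c. {s. \<exists>r. T 0 r c s}" and ?F = "{c. \<exists>s. T 0 r c s}"
  have A: "card ?A = 4"
    using face_card_third[OF F(1) _ r] face_unique[OF F(3)] by simp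
  have cardF: "card ?F = 4" using face_card_second[OF F(1) _ r] by simp
  have B: "card (?B c) = 4" if "c \<in> C" for c using face_card_second[OF F(2) _ that] by simp
  have AS: "?A \<subseteq> S" "?B c \<subseteq> S" for c using supp[OF zero_less_numeral] by blast+
  have fin: "finite ?A" "finite (?B c)" for c
    using finite_subset[OF AS(1) finS] finite_subset[OF AS(2) finS] by blast+
  have three: "card (f ` {..<3}) = 3" if "inj_on f {..<3}" for f :: "nat \<Rightarrow> 'z"
    using card_image[OF that] by simp
  show ?thesis
    unfolding concentrated_def
  proof (intro exI[of _ ?F] conjI ballI impI)
    show "?F \<subseteq> C" using supp[OF zero_less_numeral] by blast+
    show "card ?F = 4" by (rule cardF)
  next
    fix c assume c: "c \<in> ?F"
    then have "c \<in> C" using supp[OF zero_less_numeral] by blast+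
    have "\<forall>i<3. \<exists>s. T i r c s" using c face_exchange[OF F(1) zero_less_numeral] by blast
    then obtain f where f: "\<And>i. i < 3 \<Longrightarrow> T i r c (f i)" by metis
    have "inj_on f {..<3}" using disj f by (metis inj_onI lessThan_iff)
    moreover have "f ` {..<3} \<subseteq> ?A \<inter> ?B c"
      using f face_exchange[OF F(3) _ zero_less_numeral] face_exchange[OF F(2) _ zero_less_numeral] by fastforce
    moreover have "finite (?A \<inter> ?B c)" using fin(1) by simp
    ultimately have "3 \<le> card (?A \<inter> ?B c)" using three card_mono by metis
    moreover have "card (?A \<union> ?B c) + card (?A \<inter> ?B c) = 8"
      using card_Un_Int[of ?A "?B c"] A B[OF \<open>c \<in> C\<close>] fin by simp
    moreover have "card (S - (?A \<union> ?B c)) = card S - card (?A \<union> ?B c)"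
      using AS fin by (intro card_Diff_subset) auto
    moreover have "(S - ?B c) \<inter> (S - ?A) = S - (?A \<union> ?B c)" by blast
    ultimately show "d - 1 \<le> card ((S - ?B c) \<inter> (S - ?A))" using S by simp
  next
    fix c c' assume c: "c \<in> ?F" "c' \<in> ?F" "c \<noteq> c'"
    show "(S - ?B c) \<inter> (S - ?B c') \<subseteq> S - ?A"
    proof
      fix s assume s: "s \<in> (S - ?B c) \<inter> (S - ?B c')"
      have False if "s \<in> ?A"
      proof -
        have "\<forall>i<3. \<exists>x. T i r x s" using that face_exchange[OF F(3) zero_less_numeral] by blast
        then obtain f where f: "\<And>i. i < 3 \<Longrightarrow> T i r (f i) s" by metis
        have "inj_on f {..<3}" using disj f by (metis inj_onI lessThan_iff)
        moreover have "f ` {..<3} \<subseteq> ?F" using f face_exchange[OF F(1) _ zero_less_numeral] by fastforce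
        moreover have "c \<notin> f ` {..<3}" "c' \<notin> f ` {..<3}"
          using s f face_exchange[OF F(2) _ zero_less_numeral] by fastforce+
        ultimately have sub: "insert c (insert c' (f ` {..<3})) \<subseteq> ?F"
          and "card (insert c (insert c' (f ` {..<3}))) = 5"
          using c three by auto
        moreover have "finite ?F" by (rule card_ge_0_finite) (use cardF in simp)
        ultimately show False using card_mono[OF _ sub] cardF by simp
      qed
      then show "s \<in> S - ?A" using s by blast
    qed
  qed
qed

lemma block_family_if_trade:
  assumes T: "trade 3 4 R C S T" and "card S = d + 4" "card C = d + 4"
  shows "block_family d S C (\<lambda>c. S - {s. \<exists>r. T 0 r c s})"
proof -
  have F: "face 3 4 R T" "face 3 4 C (\<lambda>i c s r. T i r c s)" "face 3 4 S (\<lambda>i s r c. T i r c s)"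
    using T unfolding trade_def by blast+
  have supp: "\<And>i r c s. i < 3 \<Longrightarrow> T i r c s \<Longrightarrow> r \<in> R \<and> c \<in> C \<and> s \<in> S"
    and fin: "finite S" "finite C"
    using T unfolding trade_def by blast+
  show ?thesis
    unfolding block_family_def
  proof (intro conjI ballI fin assms(2,3))
    fix c assume "c \<in> C"
    then have "card {s. \<exists>r. T 0 r c s} = 4" using face_card_second[OF F(2)] by simp
    moreover have "{s. \<exists>r. T 0 r c s} \<subseteq> S" using supp[OF zero_less_numeral] by blast+
    ultimately show "card (S - {s. \<exists>r. T 0 r c s}) = d"
      using assms(2) fin by (simp add: card_Diff_subset finite_subset)
  next
    fix s assume s: "s \<in> S"
    then have "card {c. \<exists>r. T 0 r c s} = 4"
      using face_card_third[OF F(3) _ s] face_unique[OF F(2)] by simp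
    moreover have sub: "{c. \<exists>r. T 0 r c s} \<subseteq> C" using supp[OF zero_less_numeral] by blast+
    moreover have "{c \<in> C. s \<in> S - {s. \<exists>r. T 0 r c s}} = C - {c. \<exists>r. T 0 r c s}" using s by blast
    ultimately show "card {c \<in> C. s \<in> S - {s. \<exists>r. T 0 r c s}} = d"
      using assms(3) fin by (simp add: card_Diff_subset finite_subset)
  qed auto
qed

lemma no_trade_4:
  assumes m: "m \<in> {6, 7}"
  shows "\<not> latin_trade_exists 3 4 m"
proof
  assume "latin_trade_exists 3 4 m"
  then obtain S :: "nat set" and Ts where H: "homogeneous_latin_trade 3 4 m S Ts"
    unfolding latin_trade_exists_def by blast
  let ?T = "\<lambda>i r c s. r < m \<and> c < m \<and> (Ts ! i) r c = Some s"
  have T: "trade 3 4 {..<m} {..<m} S ?T" by (rule trade_if_homogeneous_latin_trade[OF H])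
  have T': "trade 3 4 {..<m} {..<m} S (\<lambda>i c r s. ?T i r c s)" by (rule trade_transpose[OF T])
  obtain d where d: "d \<in> {2, 3}" "m = d + 4" using m by auto
  have S: "card S = d + 4" using H d unfolding homogeneous_latin_trade_def by simp
  have m4: "card {..<m} = d + 4" using d by simp
  show False
    by (rule no_dual_concentrated_families[OF block_family_if_trade[OF T S m4]
      block_family_if_trade[OF T' S m4] d(1) concentrated_if_trade[OF T S] concentrated_if_trade[OF T' S]])
qed

section \<open>The existence spectrum\<close>

theorem theorem1:
  fixes k m :: nat
  assumes "3 \<le> k" and "k \<le> m"
  shows "(k = 4 \<and> m \<notin> {6, 7, 11} \<longrightarrow> latin_trade_exists 3 k m) \<and>
         (k = 4 \<and> m \<in> {6, 7} \<longrightarrow> \<not> latin_trade_exists 3 k m) \<and>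
         (k = 5 \<and> m \<noteq> 6 \<longrightarrow> latin_trade_exists 3 k m) \<and>
         (6 \<le> k \<and> k \<le> 13 \<longrightarrow> latin_trade_exists 3 k m) \<and>
         (k = 15 \<longrightarrow> latin_trade_exists 3 k m) \<and>
         (4 \<le> k \<and> k ^ 2 \<le> m \<longrightarrow> latin_trade_exists 3 k m) \<and>
         (4 \<le> k \<and> 5 dvd m \<and> m \<noteq> 30 \<longrightarrow> latin_trade_exists 3 k m) \<and>
         (4 \<le> k \<and> 7 dvd m \<and> m \<noteq> 42 \<and> (k, m) \<noteq> (4, 7) \<longrightarrow> latin_trade_exists 3 k m)"
proof -
  have exists: "latin_trade_exists 3 k m" if "has_trade 3 k m"
    using latin_trade_existsI[OF that] assms by simp
  have small: "latin_trade_exists 3 k m"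
    if "4 \<le> k" "k \<le> 13" "(k, m) \<notin> {(4, 6), (4, 7), (4, 11), (5, 6)}"
    by (rule exists, rule has_trade_small) (use that assms in auto)
  have square: "latin_trade_exists 3 k m" if "4 \<le> k" "k ^ 2 \<le> m"
  proof -
    have "4 * k \<le> k ^ 2" using that(1) by (simp add: power2_eq_square)
    then have m: "4 * k \<le> m" using that(2) by (rule le_trans)
    show ?thesis
    proof (cases "6 \<le> k")
      case True
      then show ?thesis using exists has_trade_large m by blast
    next
      case False
      then show ?thesis using small that m by auto
    qed
  qed
  have multiple: "latin_trade_exists 3 k m"
    if "4 \<le> k" "(k, m) \<noteq> (4, 7)" and dvd: "n dvd m" and na: "(n, a) \<in> {(5, 4), (7, 5)}" for n a :: nat
  proof (cases "k \<le> 13")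
    case True
    have "m \<noteq> 6" "m \<noteq> 11" using dvd na by auto
    then show ?thesis using small that True by auto
  next
    case False
    obtain x where "m = x * n" using dvd by (metis dvd_def mult.commute)
    then show ?thesis using exists has_trade_multiple_of_5_or_7[OF na, of k x] False assms by auto
  qed
  have five: "latin_trade_exists 3 k m" if "4 \<le> k" "5 dvd m"
  proof -
    have "(k, m) \<noteq> (4, 7)" using that(2) by auto
    then show ?thesis using multiple[OF that(1) _ that(2), of 4] by simp
  qed
  show ?thesis
    using small square five multiple[of 7 5] no_trade_4[of m]
      exists has_trade_medium[of k m] assms by auto
qed

end
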